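(* Let $k\ge 3$ be an integer. Let $Q=\mathbf{x}_1\mathbf{x}_2\mathbf{x}_3\mathbf{x}_4\subset\mathbb{R}^2$ be a quadrilateral subdivided by its two diagonals into the four triangles $T_1=\mathbf{x}_1\mathbf{x}_2\mathbf{x}_0$, $T_2=\mathbf{x}_2\mathbf{x}_3\mathbf{x}_0$, $T_3=\mathbf{x}_3\mathbf{x}_4\mathbf{x}_0$, $T_4=\mathbf{x}_4\mathbf{x}_1\mathbf{x}_0$, where $\mathbf{x}_0$ is the intersection of the diagonals $\mathbf{x}_1\mathbf{x}_3$ and $\mathbf{x}_2\mathbf{x}_4$. Then the $2k^2-2k+4$ degrees of freedom (D) and the $8k$ homogeneous linear constraints (C) listed in the context uniquely define a $C^1$-$P_k$ function on $Q$. That is: for every choice of $2k^2-2k+4$ real numbers prescribed as the values of the degrees of freedom (D), there is exactly one quadruple $(p_1,p_2,p_3,p_4)$ of polynomials in $P_k$ which takes these values and satisfies all the constraints (C); moreover, the piecewise polynomial function $p$ on $Q$ given by $p|_{T_i}=p_i$, $i=1,2,3,4$, is well defined and belongs to $C^1(Q)$.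
   Context: $P_k$ is the space of real polynomials in two variables of total degree at most $k$. The quadrilateral is non-degenerate and convex, so that the two diagonals cross at a point $\mathbf{x}_0$ in the interior of $Q$; its vertices are numbered cyclically. Indices are cyclic: $\mathbf{x}_5=\mathbf{x}_1$ and $p_0=p_4$. Polynomials are regarded as defined on all of $\mathbb{R}^2$, and $p_i$ is the polynomial attached to $T_i$. (D) Degrees of freedom. For each $i=1,2,3,4$, put $i'=i+1$ and let $\mathbf{n}$ be a fixed unit normal vector to the edge $\mathbf{x}_i\mathbf{x}_{i'}$; $\partial_{\mathbf{n}^l}$ denotes the $l$-th order directional derivative in the direction $\mathbf{n}$. The degrees of freedom are: - $p_i(\mathbf{x}_i)$, $\partial_x p_i(\mathbf{x}_i)$, $\partial_y p_i(\mathbf{x}_i)$; - $\partial_{\mathbf{n}}p_i\big(\tfrac{j\mathbf{x}_i+(k-1-j)\mathbf{x}_{i'}}{k-1}\big)$, $j=1,\dots,k-2$; - $p_i\big(\tfrac{j\mathbf{x}_i+(k-2-j)\mathbf{x}_{i'}}{k-2}\big)$, $j=1,\dots,k-3$; - $\partial_{\mathbf{n}^l}p_i\big(\tfrac{j\mathbf{x}_i+(k-l-j)\mathbf{x}_{i'}}{k-l}\big)$, $j=1,\dots,k-1-l$, $\ l=2,\dots,k-2$. (Empty index ranges contribute nothing.) (C) Constraints. The triangles $T_{i-1}$ and $T_i$ (with $T_0=T_4$) share the edge $\mathbf{x}_0\mathbf{x}_i$. Let $\partial_{\mathbf{a}\mathbf{b}^\perp}$ denote the directional derivative in a direction normal to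 the segment $\mathbf{a}\mathbf{b}$. Let $j_1=j_2=j_4=k-2$ and $j_3=k-3$. The constraints are: - for $i=1,2,3,4$: $(p_i-p_{i-1})(\mathbf{x}_i)=0$, $\partial_x(p_i-p_{i-1})(\mathbf{x}_i)=0$, $\partial_y(p_i-p_{i-1})(\mathbf{x}_i)=0$; - for $i=1,2,3,4$ and $j=1,\dots,k-3$: $(p_i-p_{i-1})\big(\tfrac{j\mathbf{x}_i+(k-2-j)\mathbf{x}_0}{k-2}\big)=0$; - for $i=1,2,3,4$ and $j=1,\dots,j_i$: $\partial_{\mathbf{x}_0\mathbf{x}_i^\perp}(p_i-p_{i-1})\big(\tfrac{j\mathbf{x}_i+(k-1-j)\mathbf{x}_0}{k-1}\big)=0$; - for $i=2,3,4$: $(p_1-p_i)(\mathbf{x}_0)=0$, $\partial_{\mathbf{x}_2\mathbf{x}_4^\perp}(p_1-p_i)(\mathbf{x}_0)=0$, $\partial_{\mathbf{x}_1\mathbf{x}_3^\perp}(p_1-p_i)(\mathbf{x}_0)=0$. *)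

theory Defs
  imports "HOL-Analysis.Analysis"
begin

text \<open>
  The four vertices and the four polynomial pieces are indexed by the numeral type \<open>4\<close>, whose
  arithmetic is modulo 4. Hence \<open>i + 1\<close> and \<open>i - 1\<close> are the cyclic successor and predecessor,
  and \<open>4 = 0\<close>.
\<close>

definition poly_space :: "nat \<Rightarrow> (real^2 \<Rightarrow> real) set" where
  "poly_space k =
     {f. \<exists>c :: nat \<Rightarrow> nat \<Rightarrow> real. \<forall>y. f y = (\<Sum>a\<le>k. \<Sum>b\<le>k - a. c a b * (y $ 1) ^ a * (y $ 2) ^ b)}"

definition dir_deriv :: "real^2 \<Rightarrow> (real^2 \<Rightarrow> real) \<Rightarrow> real^2 \<Rightarrow> real" where
  "dir_deriv v f y = deriv (\<lambda>t. f (y + t *\<^sub>R v)) 0"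

abbreviation partial_x :: "(real^2 \<Rightarrow> real) \<Rightarrow> real^2 \<Rightarrow> real" where
  "partial_x \<equiv> dir_deriv (axis 1 1)"

abbreviation partial_y :: "(real^2 \<Rightarrow> real) \<Rightarrow> real^2 \<Rightarrow> real" where
  "partial_y \<equiv> dir_deriv (axis 2 1)"

text \<open>
  A non-degenerate convex quadrilateral with cyclically numbered vertices: the line through each
  side is a supporting line, and the two vertices not on that side lie strictly on one side of
  it. Strictness makes the vertices distinct and excludes three collinear vertices.
\<close>

definition convex_quadrilateral :: "(4 \<Rightarrow> real^2) \<Rightarrow> bool" where
  "convex_quadrilateral x \<longleftrightarrow>
     (\<forall>i. \<exists>a b. a \<bullet> x i = b \<and> a \<bullet> x (i + 1) = b \<and> a \<bullet> x (i + 2) < b \<and> a \<bullet> x (i + 3) < b)"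

definition quad :: "(4 \<Rightarrow> real^2) \<Rightarrow> (real^2) set" where
  "quad x = convex hull (range x)"

definition subtriangle :: "(4 \<Rightarrow> real^2) \<Rightarrow> real^2 \<Rightarrow> 4 \<Rightarrow> (real^2) set" where
  "subtriangle x x0 i = convex hull {x i, x (i + 1), x0}"

definition normal_direction :: "real^2 \<Rightarrow> real^2 \<Rightarrow> real^2 \<Rightarrow> bool" where
  "normal_direction v a b \<longleftrightarrow> v \<noteq> 0 \<and> v \<bullet> (b - a) = 0"

definition segment_node :: "nat \<Rightarrow> nat \<Rightarrow> real^2 \<Rightarrow> real^2 \<Rightarrow> real^2" where
  "segment_node m j a b = (1 / real m) *\<^sub>R (real j *\<^sub>R a + (real m - real j) *\<^sub>R b)"

datatype dof =
    Vertex_Value 4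
  | Vertex_Dx 4
  | Vertex_Dy 4
  | Edge_Normal 4 nat
  | Edge_Value 4 nat
  | Edge_Higher 4 nat nat

definition dofs :: "nat \<Rightarrow> dof set" where
  "dofs k = range Vertex_Value \<union> range Vertex_Dx \<union> range Vertex_Dy
     \<union> {Edge_Normal i j | i j. j \<in> {1..k - 2}}
     \<union> {Edge_Value i j | i j. j \<in> {1..k - 3}}
     \<union> {Edge_Higher i l j | i l j. l \<in> {2..k - 2} \<and> j \<in> {1..k - 1 - l}}"

primrec dof_value ::
  "nat \<Rightarrow> (4 \<Rightarrow> real^2) \<Rightarrow> (4 \<Rightarrow> real^2) \<Rightarrow> (4 \<Rightarrow> real^2 \<Rightarrow> real) \<Rightarrow> dof \<Rightarrow> real" where
  "dof_value k x n p (Vertex_Value i) = p i (x i)"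
| "dof_value k x n p (Vertex_Dx i) = partial_x (p i) (x i)"
| "dof_value k x n p (Vertex_Dy i) = partial_y (p i) (x i)"
| "dof_value k x n p (Edge_Normal i j) =
     dir_deriv (n i) (p i) (segment_node (k - 1) j (x i) (x (i + 1)))"
| "dof_value k x n p (Edge_Value i j) = p i (segment_node (k - 2) j (x i) (x (i + 1)))"
| "dof_value k x n p (Edge_Higher i l j) =
     (dir_deriv (n i) ^^ l) (p i) (segment_node (k - l) j (x i) (x (i + 1)))"

datatype constr =
    Match_Value 4
  | Match_Dx 4
  | Match_Dy 4
  | Match_Edge_Value 4 nat
  | Match_Edge_Normal 4 nat
  | Centre_Value 4
  | Centre_Normal24 4
  | Centre_Normal13 4

definition constraints :: "nat \<Rightarrow> constr set" where
  "constraints k = range Match_Value \<union> range Match_Dx \<union> range Match_Dy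
     \<union> {Match_Edge_Value i j | i j. j \<in> {1..k - 3}}
     \<union> {Match_Edge_Normal i j | i j. j \<in> {1..(if i = 3 then k - 3 else k - 2)}}
     \<union> Centre_Value ` {2, 3, 4} \<union> Centre_Normal24 ` {2, 3, 4} \<union> Centre_Normal13 ` {2, 3, 4}"

text \<open>The argument \<open>\<nu>\<close> selects, for points \<open>a\<close> and \<open>b\<close>, a direction \<open>\<nu> a b\<close> normal to the segment \<open>ab\<close>.\<close>

primrec constr_value ::
  "nat \<Rightarrow> (4 \<Rightarrow> real^2) \<Rightarrow> real^2 \<Rightarrow> (real^2 \<Rightarrow> real^2 \<Rightarrow> real^2) \<Rightarrow> (4 \<Rightarrow> real^2 \<Rightarrow> real)
     \<Rightarrow> constr \<Rightarrow> real" where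
  "constr_value k x x0 \<nu> p (Match_Value i) = p i (x i) - p (i - 1) (x i)"
| "constr_value k x x0 \<nu> p (Match_Dx i) = partial_x (\<lambda>y. p i y - p (i - 1) y) (x i)"
| "constr_value k x x0 \<nu> p (Match_Dy i) = partial_y (\<lambda>y. p i y - p (i - 1) y) (x i)"
| "constr_value k x x0 \<nu> p (Match_Edge_Value i j) =
     (let y = segment_node (k - 2) j (x i) x0 in p i y - p (i - 1) y)"
| "constr_value k x x0 \<nu> p (Match_Edge_Normal i j) =
     dir_deriv (\<nu> x0 (x i)) (\<lambda>y. p i y - p (i - 1) y) (segment_node (k - 1) j (x i) x0)"
| "constr_value k x x0 \<nu> p (Centre_Value i) = p 1 x0 - p i x0"
| "constr_value k x x0 \<nu> p (Centre_Normal24 i) =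
     dir_deriv (\<nu> (x 2) (x 4)) (\<lambda>y. p 1 y - p i y) x0"
| "constr_value k x x0 \<nu> p (Centre_Normal13 i) =
     dir_deriv (\<nu> (x 1) (x 3)) (\<lambda>y. p 1 y - p i y) x0"

definition solves ::
  "nat \<Rightarrow> (4 \<Rightarrow> real^2) \<Rightarrow> real^2 \<Rightarrow> (4 \<Rightarrow> real^2) \<Rightarrow> (real^2 \<Rightarrow> real^2 \<Rightarrow> real^2)
     \<Rightarrow> (dof \<Rightarrow> real) \<Rightarrow> (4 \<Rightarrow> real^2 \<Rightarrow> real) \<Rightarrow> bool" where
  "solves k x x0 n \<nu> d p \<longleftrightarrow>
     (\<forall>i. p i \<in> poly_space k) \<and>
     (\<forall>\<delta>\<in>dofs k. dof_value k x n p \<delta> = d \<delta>) \<and>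
     (\<forall>\<gamma>\<in>constraints k. constr_value k x x0 \<nu> p \<gamma> = 0)"

text \<open>
  Continuous differentiability on a closed set \<open>S\<close> (used for convex \<open>S\<close> with nonempty interior,
  where the gradient \<open>g\<close> is unique): \<open>f\<close> has a gradient, one-sided at boundary points, that is
  continuous up to the boundary.
\<close>

definition C1_on :: "(real^2) set \<Rightarrow> (real^2 \<Rightarrow> real) \<Rightarrow> bool" where
  "C1_on S f \<longleftrightarrow>
     (\<exists>g :: real^2 \<Rightarrow> real^2. continuous_on S g \<and>
        (\<forall>y\<in>S. (f has_derivative (\<lambda>h. g y \<bullet> h)) (at y within S)))"

end

theory Submission
  imports Defs
begin

text \<open>
  The system is square: four polynomials of degree \<open>k\<close> have \<open>2 (k + 1) (k + 2) = 2 k\<^sup>2 + 6 k + 4\<close>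
  coefficients, and there are \<open>2 k\<^sup>2 - 2 k + 4\<close> degrees of freedom and \<open>8 k\<close> constraints. So it is
  enough that the constraints enforce \<open>C\<^sup>1\<close> matching and that zero data force all pieces to vanish;
  existence then follows by elimination (\<open>square_system_solvable\<close>, \<open>exists_solution\<close>).

  Matching. Along an edge from the centre \<open>x0\<close> to a vertex, the jump between the adjacent pieces and
  its normal derivative are univariate polynomials with as many zeros as their degrees allow and one
  more. Hence the jump is divisible by the square of the equation of the edge
  (\<open>jump_divisible_by_square\<close>). On the edge to \<open>x 3\<close> one normal node is left out, but the four jumps
  sum to zero and the other three are divisible by squares, which gives an additional zero at \<open>x0\<close>.
  Writing \<open>e\<close> and \<open>f\<close> for the equations of the diagonals, the pieces become
  \<open>p 3\<close>, \<open>p 4 = p 3 + f\<^sup>2 c\<close>, \<open>p 2 = p 3 + e\<^sup>2 (a + f\<^sup>2 g)\<close> and \<open>p 1 = p 3 + f\<^sup>2 c + e\<^sup>2 a\<close>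
  (\<open>pieces_from_squares\<close>). With positive and negative parts, the piecewise function is therefore
  \<open>p 3 + f\<^sub>+\<^sup>2 c + e\<^sub>+\<^sup>2 (a + f\<^sub>-\<^sup>2 g)\<close>, which is continuously differentiable on the whole plane
  (\<open>piecewise_C1\<close>).

  Uniqueness. Let \<open>u i\<close> be the equation of the side from \<open>x i\<close> to \<open>x (i + 1)\<close>. If all degrees of freedom
  vanish, then \<open>p i = (u i)\<^sup>l q\<close> for \<open>l = 2\<close>, by the same count of zeros as on the inner edges. Let such
  a factorization be given for some \<open>l\<close>. At a vertex, the difference of the powers of two adjacent
  side equations, with their cofactors, is divisible by the square of the equation of the diagonal.
  Since \<open>\<alpha> s\<^sup>l - \<beta> t\<^sup>l\<close> has no multiple linear factor other than \<open>s\<close> and \<open>t\<close> unless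
  \<open>\<alpha> = \<beta> = 0\<close>, the cofactors vanish at the vertex (\<open>cofactor_vertex\<close>). These two end values
  and the degrees of freedom of order \<open>l\<close> annihilate the cofactor on the side, so \<open>l\<close> can be raised, up
  to \<open>l = k\<close>. There the cofactor is a constant that vanishes at a vertex (\<open>pieces_zero\<close>).
\<close>


section \<open>Polynomials of bounded degree in the plane\<close>

lemma monomial_in_poly_space:
  assumes "a + b \<le> k"
  shows "(\<lambda>y. c * (y $ 1) ^ a * (y $ 2) ^ b) \<in> poly_space k"
proof -
  have "c * (y $ 1) ^ a * (y $ 2) ^ b =
      (\<Sum>a'\<le>k. \<Sum>b'\<le>k - a'. (if a' = a \<and> b' = b then c else 0) * (y $ 1) ^ a' * (y $ 2) ^ b')"
    (is "_ = (\<Sum>a'\<le>k. ?g a')") for y :: "real^2"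
  proof -
    have "?g a' = (if a' = a then c * (y $ 1) ^ a * (y $ 2) ^ b else 0)" for a'
      using assms by (auto simp: if_distrib[of "\<lambda>u. u * _"] sum.delta cong: if_cong)
    then show ?thesis using assms by (simp add: sum.delta)
  qed
  then show ?thesis unfolding poly_space_def
    by (intro CollectI exI[where x="\<lambda>a' b'. if a' = a \<and> b' = b then c else 0"]) simp
qed

lemma poly_space_add:
  assumes "f \<in> poly_space k" "g \<in> poly_space k"
  shows "(\<lambda>y. f y + g y) \<in> poly_space k"
proof -
  obtain c d where "\<And>y. f y = (\<Sum>a\<le>k. \<Sum>b\<le>k - a. c a b * (y $ 1) ^ a * (y $ 2) ^ b)"
    and "\<And>y. g y = (\<Sum>a\<le>k. \<Sum>b\<le>k - a. d a b * (y $ 1) ^ a * (y $ 2) ^ b)"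
    using assms unfolding poly_space_def by auto
  then have "f y + g y = (\<Sum>a\<le>k. \<Sum>b\<le>k - a. (c a b + d a b) * (y $ 1) ^ a * (y $ 2) ^ b)" for y
    by (simp add: sum.distrib distrib_right)
  then show ?thesis unfolding poly_space_def
    by (intro CollectI exI[where x="\<lambda>a b. c a b + d a b"]) simp
qed

lemma poly_space_induct [consumes 1, case_names monomial add]:
  assumes f: "f \<in> poly_space k"
    and mono: "\<And>a b c. a + b \<le> k \<Longrightarrow> Q (\<lambda>y. c * (y $ 1) ^ a * (y $ 2) ^ b)"
    and add: "\<And>f g. Q f \<Longrightarrow> Q g \<Longrightarrow> Q (\<lambda>y. f y + g y)"
  shows "Q f"
proof -
  obtain c where c: "\<And>y. f y = (\<Sum>a\<le>k. \<Sum>b\<le>k - a. c a b * (y $ 1) ^ a * (y $ 2) ^ b)"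
    using f unfolding poly_space_def by auto
  have sum: "Q (\<lambda>y. \<Sum>i\<in>S. h i y)"
    if "finite S" "\<And>i. i \<in> S \<Longrightarrow> Q (h i)" for S :: "nat set" and h
    using that by (induction S) (use mono[of 0 0 0] add in auto)
  have "Q (\<lambda>y. \<Sum>a\<le>k. \<Sum>b\<le>k - a. c a b * (y $ 1) ^ a * (y $ 2) ^ b)"
    by (intro sum mono) auto
  moreover have "f = (\<lambda>y. \<Sum>a\<le>k. \<Sum>b\<le>k - a. c a b * (y $ 1) ^ a * (y $ 2) ^ b)"
    using c by (simp add: fun_eq_iff)
  ultimately show ?thesis by simp
qed

lemma poly_space_mono:
  assumes "f \<in> poly_space k" "k \<le> m"
  shows "f \<in> poly_space m"
  using assms(1)
  by (induction rule: poly_space_induct) (use assms(2) in \<open>auto intro: monomial_in_poly_space poly_space_add\<close>)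

lemma const_in_poly_space: "(\<lambda>y. c) \<in> poly_space k"
  using monomial_in_poly_space[of 0 0 k c] by simp

lemma coordinate_in_poly_space:
  assumes "1 \<le> k"
  shows "(\<lambda>y. y $ i) \<in> poly_space k"
  using monomial_in_poly_space[of 1 0 k 1] monomial_in_poly_space[of 0 1 k 1] exhaust_2[of i] assms
  by auto

lemma poly_space_sum:
  assumes "\<And>i. i \<in> S \<Longrightarrow> h i \<in> poly_space k"
  shows "(\<lambda>y. \<Sum>i\<in>S. h i y) \<in> poly_space k"
  using assms by (induction S rule: infinite_finite_induct) (auto intro: const_in_poly_space poly_space_add)

lemma poly_space_mult:
  assumes "f \<in> poly_space k" "g \<in> poly_space m"
  shows "(\<lambda>y. f y * g y) \<in> poly_space (k + m)"
  using assms(1)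
proof (induction rule: poly_space_induct)
  case (monomial a b c)
  show ?case using assms(2)
  proof (induction rule: poly_space_induct)
    case (monomial a' b' c')
    with \<open>a + b \<le> k\<close> show ?case
      using monomial_in_poly_space[of "a + a'" "b + b'" "k + m" "c * c'"]
      by (simp add: power_add algebra_simps)
  next
    case (add f g)
    then show ?case using poly_space_add by (simp add: distrib_left)
  qed
next
  case (add f g)
  then show ?case using poly_space_add by (simp add: distrib_right)
qed

lemma poly_space_scale: "f \<in> poly_space k \<Longrightarrow> (\<lambda>y. c * f y) \<in> poly_space k"
  using poly_space_mult[OF const_in_poly_space[of c 0]] by simp

lemma poly_space_uminus: "f \<in> poly_space k \<Longrightarrow> (\<lambda>y. - f y) \<in> poly_space k"
  using poly_space_scale[of f k "-1"] by simp

lemma poly_space_diff: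
  "f \<in> poly_space k \<Longrightarrow> g \<in> poly_space k \<Longrightarrow> (\<lambda>y. f y - g y) \<in> poly_space k"
  using poly_space_add[OF _ poly_space_uminus] by simp

lemma poly_space_power:
  assumes "f \<in> poly_space k"
  shows "(\<lambda>y. f y ^ n) \<in> poly_space (n * k)"
  by (induction n) (use const_in_poly_space[of 1 0] poly_space_mult[OF assms] in auto)

lemma poly_space_compose_affine:
  assumes "f \<in> poly_space k" and A: "\<And>i. (\<lambda>y. A y $ i) \<in> poly_space 1"
  shows "(\<lambda>y. f (A y)) \<in> poly_space k"
  using assms(1)
proof (induction rule: poly_space_induct)
  case (monomial a b c)
  have "(\<lambda>y. c * (A y $ 1) ^ a * (A y $ 2) ^ b) \<in> poly_space (0 + a * 1 + b * 1)"
    by (intro poly_space_mult poly_space_power A const_in_poly_space)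
  with monomial show ?case by (auto intro: poly_space_mono)
qed (auto intro: poly_space_add)

lemma affine_in_poly_space:
  assumes "1 \<le> k"
  shows "(\<lambda>y. e \<bullet> (y - z)) \<in> poly_space k"
  unfolding inner_vec_def sum_2 vector_minus_component inner_real_def
  by (intro poly_space_add poly_space_scale poly_space_diff coordinate_in_poly_space
        const_in_poly_space assms)

lemma poly_space_coefficients_unique:
  fixes c :: "nat \<Rightarrow> nat \<Rightarrow> real"
  assumes "\<And>y :: real^2. (\<Sum>a\<le>k. \<Sum>b\<le>k - a. c a b * (y $ 1) ^ a * (y $ 2) ^ b) = 0"
    and "a + b \<le> k"
  shows "c a b = 0"
proof -
  have "(\<Sum>a\<le>k. (\<Sum>b\<le>k - a. c a b * t ^ b) * s ^ a) = 0" for s t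
    using assms(1)[of "vector [s, t]"]
    by (simp add: vector_2 sum_distrib_left mult_ac)
  then have "\<forall>t. (\<Sum>b\<le>k - a. c a b * t ^ b) = 0"
    using assms(2) polyfun_eq_0[of "\<lambda>a. \<Sum>b\<le>k - a. c a b * _ ^ b" k] by force
  then show ?thesis using assms(2) polyfun_eq_0[of "c a" "k - a"] by auto
qed

text \<open>
  Choosing affine coordinates \<open>u, v\<close> in which the line is \<open>u = 0\<close>, a polynomial vanishing on
  the line has no pure power of \<open>v\<close> among its monomials, so \<open>u\<close> divides each of them.
  Truncated subtraction is harmless: a constant vanishing on a line is \<open>0\<close>.
\<close>

lemma poly_space_factor_line:
  fixes e z :: "real^2"
  assumes f: "f \<in> poly_space k" and e: "e \<noteq> 0"
    and zero: "\<And>y. e \<bullet> (y - z) = 0 \<Longrightarrow> f y = 0"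
  obtains g where "g \<in> poly_space (k - 1)" "\<And>y. f y = (e \<bullet> (y - z)) * g y"
proof -
  \<comment> \<open>\<open>e\<close> rotated by a quarter turn; \<open>B\<close> inverts the coordinate map \<open>y \<mapsto> (u y, v y)\<close>.\<close>
  define e' :: "real^2" where "e' = vector [- e $ 2, e $ 1]"
  define B :: "real^2 \<Rightarrow> real^2"
    where "B y = z + (1 / (e \<bullet> e)) *\<^sub>R ((y $ 1) *\<^sub>R e + (y $ 2) *\<^sub>R e')" for y
  define u where "u y = e \<bullet> (y - z)" for y
  define v where "v y = e' \<bullet> (y - z)" for y
  have ee: "e \<bullet> e > 0" using e by simp
  then have sq: "(e $ 1)\<^sup>2 + (e $ 2)\<^sup>2 > 0" by (simp add: inner_vec_def sum_2 power2_eq_square)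
  have e'e: "e \<bullet> e' = 0" "e' \<bullet> e' = e \<bullet> e"
    by (simp_all add: e'_def inner_vec_def sum_2)
  have By: "B (vector [u y, v y]) = y" for y
  proof -
    have "(u y *\<^sub>R e + v y *\<^sub>R e') = (e \<bullet> e) *\<^sub>R (y - z)"
      by (simp add: vec_eq_iff forall_2 u_def v_def e'_def inner_vec_def sum_2 algebra_simps)
    then show ?thesis using ee by (simp add: B_def vector_2)
  qed
  have uB: "u (B y) = y $ 1" for y
    using ee e'e by (simp add: u_def B_def inner_add_right)
  have "(\<lambda>y. B y $ i) \<in> poly_space 1" for i
    unfolding B_def vector_add_component vector_scaleR_component real_scaleR_def
    by (subst mult.commute[of "_ $ 1"], subst mult.commute[of "_ $ 2"])
       (intro poly_space_add poly_space_scale const_in_poly_space coordinate_in_poly_space, auto)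
  then have "(\<lambda>y. f (B y)) \<in> poly_space k"
    by (rule poly_space_compose_affine[OF f])
  then obtain c where c: "\<And>y. f (B y) = (\<Sum>a\<le>k. \<Sum>b\<le>k - a. c a b * (y $ 1) ^ a * (y $ 2) ^ b)"
    unfolding poly_space_def by auto
  have c0: "c 0 b = 0" if "b \<le> k" for b
  proof -
    have "(\<Sum>b\<le>k. c 0 b * t ^ b) = 0" for t
    proof -
      have "(\<Sum>a\<le>k. \<Sum>b\<le>k - a. c a b * 0 ^ a * t ^ b) = (\<Sum>b\<le>k. c 0 b * t ^ b)"
        by (subst sum.atMost_shift) simp
      then show ?thesis
        using c[of "vector [0, t]"] zero[of "B (vector [0, t])"] uB[of "vector [0, t]"]
        by (simp add: vector_2 u_def)
    qed
    then show ?thesis using that polyfun_eq_0[of "c 0" k] by auto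
  qed
  have fy: "f y = (\<Sum>a\<le>k. \<Sum>b\<le>k - a. c a b * u y ^ a * v y ^ b)" for y
    using c[of "vector [u y, v y]"] By by (simp add: vector_2)
  show ?thesis
  proof (cases k)
    case 0
    then have "f y = 0" for y using fy c0 by simp
    then show ?thesis using that[of "\<lambda>y. 0"] const_in_poly_space by simp
  next
    case (Suc m)
    define g where "g y = (\<Sum>a\<le>m. \<Sum>b\<le>m - a. c (Suc a) b * u y ^ a * v y ^ b)" for y
    have "f y = u y * g y" for y
    proof -
      have "f y = (\<Sum>a\<le>m. \<Sum>b\<le>m - a. c (Suc a) b * u y ^ Suc a * v y ^ b)"
        using fy c0 unfolding Suc by (simp add: sum.atMost_Suc_shift del: sum.atMost_Suc)
      then show ?thesis by (simp add: g_def sum_distrib_left mult_ac)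
    qed
    moreover have "g \<in> poly_space (k - 1)"
    proof -
      have "(\<lambda>y. c (Suc a) b * u y ^ a * v y ^ b) \<in> poly_space m" if "a \<le> m" "b \<le> m - a" for a b
      proof (rule poly_space_mono)
        show "(\<lambda>y. c (Suc a) b * u y ^ a * v y ^ b) \<in> poly_space (0 + a * 1 + b * 1)"
          unfolding u_def v_def
          by (intro poly_space_mult poly_space_power const_in_poly_space affine_in_poly_space) auto
      qed (use that in auto)
      then have "(\<lambda>y. \<Sum>a\<le>m. \<Sum>b\<le>m - a. c (Suc a) b * u y ^ a * v y ^ b) \<in> poly_space m"
        by (intro poly_space_sum) auto
      then show ?thesis using Suc by (simp add: g_def[abs_def])
    qed
    ultimately show ?thesis using that by (auto simp: u_def)
  qed
qed

section \<open>Directional derivatives of polynomials\<close>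

lemma dir_deriv_eq:
  assumes "(f has_derivative f') (at y)"
  shows "dir_deriv v f y = f' v"
proof -
  have "((\<lambda>t. y + t *\<^sub>R v) has_derivative (\<lambda>t. t *\<^sub>R v)) (at 0)"
    by (auto intro!: derivative_eq_intros)
  moreover have "(f has_derivative f') (at (y + 0 *\<^sub>R v))" using assms by simp
  ultimately have "((\<lambda>t. f (y + t *\<^sub>R v)) has_derivative (\<lambda>t. f' (t *\<^sub>R v))) (at 0)"
    by (rule has_derivative_compose)
  moreover have "f' (t *\<^sub>R v) = f' v * t" for t
    using linear_scale[OF has_derivative_linear[OF assms]] by simp
  ultimately have "((\<lambda>t. f (y + t *\<^sub>R v)) has_real_derivative f' v) (at 0)"
    by (simp add: has_field_derivative_def)
  then show ?thesis unfolding dir_deriv_def by (rule DERIV_imp_deriv)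
qed

lemma poly_space_has_gradient:
  assumes "f \<in> poly_space k"
  shows "\<exists>g. (\<forall>i. (\<lambda>y. g y $ i) \<in> poly_space (k - 1)) \<and>
    (\<forall>y. (f has_derivative (\<lambda>h. g y \<bullet> h)) (at y))"
  using assms
proof (induction rule: poly_space_induct)
  case (monomial a b c)
  have *: "((\<lambda>y::real^2. y $ i) has_derivative (\<lambda>h. h $ i)) (at y)" for i y
    by (intro bounded_linear_imp_has_derivative bounded_linear_vec_nth)
  define g :: "real^2 \<Rightarrow> real^2" where
    "g y = vector [(c * real a) * (y $ 1) ^ (a - 1) * (y $ 2) ^ b,
                   (c * real b) * (y $ 1) ^ a * (y $ 2) ^ (b - 1)]" for y
  have "(\<lambda>y. g y $ i) \<in> poly_space (k - 1)" for i
  proof -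
    have "(\<lambda>y. g y $ 1) \<in> poly_space (k - 1)"
      using monomial_in_poly_space[of "a - 1" b "k - 1" "c * real a"] monomial
      by (cases a) (auto simp: g_def vector_2 const_in_poly_space)
    moreover have "(\<lambda>y. g y $ 2) \<in> poly_space (k - 1)"
      using monomial_in_poly_space[of a "b - 1" "k - 1" "c * real b"] monomial
      by (cases b) (auto simp: g_def vector_2 const_in_poly_space)
    ultimately show ?thesis using exhaust_2[of i] by auto
  qed
  moreover have "((\<lambda>y. c * (y $ 1) ^ a * (y $ 2) ^ b) has_derivative (\<lambda>h. g y \<bullet> h)) (at y)" for y
    by (rule derivative_eq_intros * refl)+
       (auto simp: g_def inner_vec_def sum_2 vector_2 algebra_simps fun_eq_iff)
  ultimately show ?case by blast
next
  case (add f1 f2)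
  then obtain g1 g2 where g: "\<forall>i. (\<lambda>y. g1 y $ i) \<in> poly_space (k - 1)"
    "\<forall>y. (f1 has_derivative (\<lambda>h. g1 y \<bullet> h)) (at y)"
    "\<forall>i. (\<lambda>y. g2 y $ i) \<in> poly_space (k - 1)"
    "\<forall>y. (f2 has_derivative (\<lambda>h. g2 y \<bullet> h)) (at y)" by blast
  then have "\<forall>i. (\<lambda>y. (g1 y + g2 y) $ i) \<in> poly_space (k - 1)"
    by (simp add: poly_space_add)
  moreover have "((\<lambda>y. f1 y + f2 y) has_derivative (\<lambda>h. (g1 y + g2 y) \<bullet> h)) (at y)" for y
    using has_derivative_add g(2,4) by (fastforce simp: inner_add_left)
  ultimately show ?case by (intro exI[where x="\<lambda>y. g1 y + g2 y"]) auto
qed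

definition polynomial_map :: "(real^2 \<Rightarrow> real) \<Rightarrow> bool" where
  "polynomial_map f \<longleftrightarrow> (\<exists>k. f \<in> poly_space k)"

lemma polynomial_mapI: "f \<in> poly_space k \<Longrightarrow> polynomial_map f"
  by (auto simp: polynomial_map_def)

lemma polynomial_map_intros [intro]:
  "polynomial_map (\<lambda>y. c)"
  "polynomial_map (\<lambda>y. e \<bullet> (y - z))"
  "polynomial_map f \<Longrightarrow> polynomial_map g \<Longrightarrow> polynomial_map (\<lambda>y. f y + g y)"
  "polynomial_map f \<Longrightarrow> polynomial_map g \<Longrightarrow> polynomial_map (\<lambda>y. f y - g y)"
  "polynomial_map f \<Longrightarrow> polynomial_map g \<Longrightarrow> polynomial_map (\<lambda>y. f y * g y)"
  "polynomial_map f \<Longrightarrow> polynomial_map (\<lambda>y. f y ^ n)"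
  unfolding polynomial_map_def
  subgoal using const_in_poly_space by blast
  subgoal using affine_in_poly_space by blast
  subgoal
    by (elim exE, rule exI[of _ "max _ _"], rule poly_space_add)
       (rule poly_space_mono[OF _ max.cobounded1] poly_space_mono[OF _ max.cobounded2], assumption)+
  subgoal
    by (elim exE, rule exI[of _ "max _ _"], rule poly_space_diff)
       (rule poly_space_mono[OF _ max.cobounded1] poly_space_mono[OF _ max.cobounded2], assumption)+
  subgoal using poly_space_mult by blast
  subgoal using poly_space_power by blast
  done

lemma dir_deriv_in_poly_space:
  assumes "f \<in> poly_space k"
  shows "dir_deriv v f \<in> poly_space (k - 1)"
proof -
  obtain g where g: "\<forall>i. (\<lambda>y. g y $ i) \<in> poly_space (k - 1)"
    "\<forall>y. (f has_derivative (\<lambda>h. g y \<bullet> h)) (at y)"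
    using poly_space_has_gradient[OF assms] by blast
  then have "dir_deriv v f = (\<lambda>y. v $ 1 * g y $ 1 + v $ 2 * g y $ 2)"
    by (simp add: fun_eq_iff dir_deriv_eq[OF g(2)[rule_format]] inner_vec_def sum_2 mult.commute)
  then show ?thesis using g(1) by (auto intro!: poly_space_add poly_space_scale)
qed

lemma polynomial_map_dir_deriv [intro]: "polynomial_map f \<Longrightarrow> polynomial_map (dir_deriv v f)"
  unfolding polynomial_map_def by (meson dir_deriv_in_poly_space)

lemma polynomial_map_has_derivative:
  assumes "polynomial_map f"
  shows "(f has_derivative (\<lambda>v. dir_deriv v f y)) (at y)"
proof -
  obtain f' where f': "(f has_derivative f') (at y)"
    using assms poly_space_has_gradient unfolding polynomial_map_def by blast
  then have "f' = (\<lambda>v. dir_deriv v f y)" by (auto simp: fun_eq_iff dir_deriv_eq)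
  with f' show ?thesis by simp
qed

lemma polynomial_map_continuous:
  assumes "polynomial_map f"
  shows "continuous_on S f"
  using has_derivative_continuous[OF polynomial_map_has_derivative[OF assms]]
  by (simp add: continuous_at_imp_continuous_on)

lemma dir_deriv_linear:
  assumes "polynomial_map f"
  shows "linear (\<lambda>v. dir_deriv v f y)"
  using has_derivative_linear[OF polynomial_map_has_derivative[OF assms]] .

lemma dir_deriv_const [simp]: "dir_deriv v (\<lambda>y. c) = (\<lambda>y. 0)"
  by (simp add: fun_eq_iff dir_deriv_def)

lemma dir_deriv_affine [simp]: "dir_deriv v (\<lambda>y. e \<bullet> (y - z)) = (\<lambda>y. e \<bullet> v)"
proof
  fix y
  have "((\<lambda>y. e \<bullet> (y - z)) has_derivative (\<lambda>v. e \<bullet> v)) (at y)"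
    by (auto intro!: derivative_eq_intros)
  then show "dir_deriv v (\<lambda>y. e \<bullet> (y - z)) y = e \<bullet> v" by (rule dir_deriv_eq)
qed

lemma dir_deriv_add:
  assumes "polynomial_map f" "polynomial_map g"
  shows "dir_deriv v (\<lambda>y. f y + g y) = (\<lambda>y. dir_deriv v f y + dir_deriv v g y)"
  using dir_deriv_eq[OF has_derivative_add[OF assms[THEN polynomial_map_has_derivative]]]
  by (simp add: fun_eq_iff)

lemma dir_deriv_diff:
  assumes "polynomial_map f" "polynomial_map g"
  shows "dir_deriv v (\<lambda>y. f y - g y) = (\<lambda>y. dir_deriv v f y - dir_deriv v g y)"
  using dir_deriv_eq[OF has_derivative_diff[OF assms[THEN polynomial_map_has_derivative]]]
  by (simp add: fun_eq_iff)

lemma dir_deriv_mult: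
  assumes "polynomial_map f" "polynomial_map g"
  shows "dir_deriv v (\<lambda>y. f y * g y) = (\<lambda>y. f y * dir_deriv v g y + dir_deriv v f y * g y)"
  using dir_deriv_eq[OF has_derivative_mult[OF assms[THEN polynomial_map_has_derivative]]]
  by (simp add: fun_eq_iff)

lemma dir_deriv_power:
  assumes "polynomial_map f"
  shows "dir_deriv v (\<lambda>y. f y ^ n) = (\<lambda>y. real n * f y ^ (n - 1) * dir_deriv v f y)"
  using dir_deriv_eq[OF has_derivative_power[OF polynomial_map_has_derivative[OF assms]]]
  by (simp add: fun_eq_iff mult_ac)

lemma dir_deriv_scale:
  assumes "polynomial_map f"
  shows "dir_deriv v (\<lambda>y. c * f y) = (\<lambda>y. c * dir_deriv v f y)"
  using dir_deriv_mult[OF polynomial_map_intros(1) assms] by simp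

lemma polynomial_map_iterated_dir_deriv:
  "polynomial_map f \<Longrightarrow> polynomial_map ((dir_deriv v ^^ l) f)"
  by (induction l) auto

lemma iterated_dir_deriv_add:
  assumes "polynomial_map f" "polynomial_map g"
  shows "(dir_deriv v ^^ l) (\<lambda>y. f y + g y) = (\<lambda>y. (dir_deriv v ^^ l) f y + (dir_deriv v ^^ l) g y)"
  by (induction l) (simp_all add: dir_deriv_add polynomial_map_iterated_dir_deriv assms)

lemma iterated_dir_deriv_scale:
  assumes "polynomial_map f"
  shows "(dir_deriv v ^^ l) (\<lambda>y. c * f y) = (\<lambda>y. c * (dir_deriv v ^^ l) f y)"
  by (induction l) (simp_all add: dir_deriv_scale polynomial_map_iterated_dir_deriv assms)

text \<open>
  Differentiating \<open>u\<^sup>l q\<close> exactly \<open>l\<close> times leaves, on the line \<open>u = 0\<close>, only the term in which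
  every derivative has hit a different factor \<open>u\<close>.
\<close>

lemma iterated_dir_deriv_on_line:
  assumes "polynomial_map q" "e \<bullet> (y - z) = 0"
  shows "(dir_deriv v ^^ l) (\<lambda>y. (e \<bullet> (y - z)) ^ l * q y) y = fact l * (e \<bullet> v) ^ l * q y"
  using assms(1)
proof (induction l arbitrary: q)
  case 0
  then show ?case by simp
next
  case (Suc l)
  define r where "r y = real (Suc l) * (e \<bullet> v) * q y + (e \<bullet> (y - z)) * dir_deriv v q y" for y
  have r: "polynomial_map r" unfolding r_def[abs_def]
    by (intro polynomial_map_intros polynomial_map_dir_deriv Suc.prems)
  have "dir_deriv v (\<lambda>y. (e \<bullet> (y - z)) ^ Suc l * q y) = (\<lambda>y. (e \<bullet> (y - z)) ^ l * r y)"
    by (subst dir_deriv_mult[OF polynomial_map_intros(6)[OF polynomial_map_intros(2)] Suc.prems],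
        subst dir_deriv_power[OF polynomial_map_intros(2)], unfold dir_deriv_affine)
       (simp add: fun_eq_iff r_def algebra_simps)
  then have "(dir_deriv v ^^ Suc l) (\<lambda>y. (e \<bullet> (y - z)) ^ Suc l * q y) y
      = (dir_deriv v ^^ l) (\<lambda>y. (e \<bullet> (y - z)) ^ l * r y) y"
    by (simp add: funpow_swap1)
  also have "\<dots> = fact l * (e \<bullet> v) ^ l * r y" by (rule Suc.IH[OF r])
  also have "\<dots> = fact (Suc l) * (e \<bullet> v) ^ Suc l * q y"
    using assms(2) by (simp add: r_def algebra_simps)
  finally show ?case .
qed


section \<open>Zeros on lines\<close>

lemma poly_eq_0_if_many_zeros:
  fixes p :: "real poly"
  assumes "finite Z" "D \<subseteq> Z"
    and Z: "\<And>z. z \<in> Z \<Longrightarrow> poly p z = 0"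
    and D: "\<And>z. z \<in> D \<Longrightarrow> poly (pderiv p) z = 0"
    and deg: "degree p < card Z + card D"
  shows "p = 0"
proof (rule ccontr)
  assume p: "p \<noteq> 0"
  have order: "(if z \<in> D then 2 else 1) \<le> order z p" if z: "z \<in> Z" for z
  proof -
    have 1: "order z p \<noteq> 0" using Z[OF z] p by (simp add: order_root)
    moreover have "2 \<le> order z p" if "z \<in> D"
    proof -
      have "pderiv p \<noteq> 0"
      proof
        assume "pderiv p = 0"
        then have "degree p = 0" by (simp add: pderiv_eq_0_iff)
        then obtain c where "p = [:c:]" by (rule degree_eq_zeroE)
        then show False using Z[OF z] p by simp
      qed
      have "order z p = Suc (order z (pderiv p))" by (rule order_pderiv[OF p Z[OF z]])
      moreover have "order z (pderiv p) \<noteq> 0"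
        using D[OF that] \<open>pderiv p \<noteq> 0\<close> by (simp add: order_root)
      ultimately show ?thesis by simp
    qed
    ultimately show ?thesis by auto
  qed
  have "card Z + card D = (\<Sum>z\<in>Z. if z \<in> D then 2 else 1)"
  proof -
    have "(\<Sum>z\<in>Z. if z \<in> D then 2 else 1 :: nat) = (\<Sum>z\<in>Z. 1 + (if z \<in> D then 1 else 0))"
      by (intro sum.cong) auto
    also have "\<dots> = card Z + card (Z \<inter> D)"
      using \<open>finite Z\<close> by (simp only: sum.distrib) (simp add: sum.If_cases)
    finally show ?thesis using \<open>D \<subseteq> Z\<close> by (simp add: Int_absorb1)
  qed
  also have "\<dots> \<le> (\<Sum>z\<in>Z. order z p)" by (intro sum_mono order)
  also have "\<dots> \<le> (\<Sum>z | poly p z = 0. order z p)"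
    using Z poly_roots_finite[OF p] by (intro sum_mono2) auto
  also have "\<dots> \<le> degree p" by (rule sum_order_le_degree[OF p])
  finally show False using deg by simp
qed

lemma poly_space_on_line:
  assumes "f \<in> poly_space k"
  shows "\<exists>p. degree p \<le> k \<and> (\<forall>t. f (b + t *\<^sub>R w) = poly p t)"
  using assms
proof (induction rule: poly_space_induct)
  case (monomial a b' c)
  have "degree ([:b $ i, w $ i:] ^ n) \<le> n" for i n
    using degree_power_le[of "[:b $ i, w $ i:]" n] by (auto split: if_splits)
  then have "degree ([:b $ 1, w $ 1:] ^ a * [:b $ 2, w $ 2:] ^ b') \<le> k"
    using degree_mult_le[of "[:b $ 1, w $ 1:] ^ a" "[:b $ 2, w $ 2:] ^ b'"] monomial
    by (meson add_mono order_trans)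
  then have "degree (smult c ([:b $ 1, w $ 1:] ^ a * [:b $ 2, w $ 2:] ^ b')) \<le> k"
    using degree_smult_le order_trans by blast
  then show ?case
    by (intro exI[of _ "smult c ([:b $ 1, w $ 1:] ^ a * [:b $ 2, w $ 2:] ^ b')"]) simp
next
  case (add f g)
  then obtain p q where "degree p \<le> k" "degree q \<le> k"
    "\<forall>t. f (b + t *\<^sub>R w) = poly p t" "\<forall>t. g (b + t *\<^sub>R w) = poly q t" by blast
  then show ?case by (intro exI[of _ "p + q"]) (simp add: degree_add_le)
qed

lemma segment_node_eq:
  assumes "m > 0"
  shows "segment_node m j a b = b + (real j / real m) *\<^sub>R (a - b)"
proof -
  have "real j *\<^sub>R a + (real m - real j) *\<^sub>R b = real m *\<^sub>R b + real j *\<^sub>R (a - b)"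
    by (simp add: scaleR_left_diff_distrib scaleR_right_diff_distrib)
  then show ?thesis using assms by (simp add: segment_node_def scaleR_add_right)
qed

lemma segment_node_ends:
  assumes "m > 0"
  shows "segment_node m 0 a b = b" "segment_node m m a b = a"
  using assms by (simp_all add: segment_node_eq)

text \<open>
  Along the line through \<open>a\<close> and \<open>b\<close> the polynomial is univariate of degree at most \<open>d\<close>;
  \<open>J\<close> collects zeros of it among the equally spaced nodes and \<open>D\<close> double ones.
\<close>

lemma vanishes_on_segment_line:
  assumes f: "f \<in> poly_space d" and m: "m > 0"
    and "J \<subseteq> {0..m}" "D \<subseteq> J"
    and J: "\<And>j. j \<in> J \<Longrightarrow> f (segment_node m j a b) = 0"
    and D: "\<And>j. j \<in> D \<Longrightarrow> dir_deriv (a - b) f (segment_node m j a b) = 0"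
    and deg: "d < card J + card D"
  shows "f (b + t *\<^sub>R (a - b)) = 0"
proof -
  obtain p where p: "degree p \<le> d" "\<And>t. f (b + t *\<^sub>R (a - b)) = poly p t"
    using poly_space_on_line[OF f] by blast
  have pd: "dir_deriv (a - b) f (b + t *\<^sub>R (a - b)) = poly (pderiv p) t" for t
  proof -
    have "((\<lambda>s. poly p (t + s)) has_real_derivative poly (pderiv p) t) (at 0)"
      by (rule derivative_eq_intros poly_DERIV | simp)+
    moreover have "(\<lambda>s. f (b + t *\<^sub>R (a - b) + s *\<^sub>R (a - b))) = (\<lambda>s. poly p (t + s))"
      using p(2)[of "t + _"] by (simp add: algebra_simps)
    ultimately show ?thesis unfolding dir_deriv_def by (simp add: DERIV_imp_deriv)
  qed
  define node where "node j = real j / real m" for j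
  have inj: "inj_on node A" for A using m by (auto simp: node_def inj_on_def)
  have "finite J" using assms(3) finite_subset by blast
  have "p = 0"
  proof (rule poly_eq_0_if_many_zeros)
    show "finite (node ` J)" using \<open>finite J\<close> by simp
    show "node ` D \<subseteq> node ` J" using \<open>D \<subseteq> J\<close> by blast
    show "poly p z = 0" if "z \<in> node ` J" for z
      using that J p(2) m by (auto simp: node_def segment_node_eq)
    show "poly (pderiv p) z = 0" if "z \<in> node ` D" for z
      using that D pd m by (auto simp: node_def segment_node_eq)
    show "degree p < card (node ` J) + card (node ` D)"
      using deg p(1) by (simp add: card_image inj)
  qed
  then show ?thesis using p(2) by simp
qed

lemma perpendicular_in_plane:
  fixes e w v :: "real^2"
  assumes "e \<noteq> 0" "w \<noteq> 0" "e \<bullet> w = 0" "e \<bullet> v = 0"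
  obtains t where "v = t *\<^sub>R w"
proof -
  have ww: "w \<bullet> w > 0" using assms by simp
  have cross: "v $ 1 * w $ 2 = v $ 2 * w $ 1"
  proof -
    have "e $ 1 * (v $ 1 * w $ 2 - v $ 2 * w $ 1) = 0" "e $ 2 * (v $ 1 * w $ 2 - v $ 2 * w $ 1) = 0"
      using assms(3,4) unfolding inner_vec_def sum_2 inner_real_def by algebra+
    moreover have "e $ 1 \<noteq> 0 \<or> e $ 2 \<noteq> 0" using assms(1) by (auto simp: vec_eq_iff forall_2)
    ultimately show ?thesis by auto
  qed
  have "(w \<bullet> w) *\<^sub>R v = (v \<bullet> w) *\<^sub>R w"
    using cross unfolding vec_eq_iff forall_2 inner_vec_def sum_2 inner_real_def vector_scaleR_component
      real_scaleR_def by algebra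
  then have "(1 / (w \<bullet> w)) *\<^sub>R ((w \<bullet> w) *\<^sub>R v) = ((v \<bullet> w) / (w \<bullet> w)) *\<^sub>R w"
    by simp
  then have "v = ((v \<bullet> w) / (w \<bullet> w)) *\<^sub>R w" using ww by simp
  then show ?thesis using that by blast
qed

lemma poly_space_factor:
  fixes e w z :: "real^2"
  assumes f: "f \<in> poly_space k" and e: "e \<noteq> 0" and w: "w \<noteq> 0" "e \<bullet> w = 0"
    and zero: "\<And>t. f (z + t *\<^sub>R w) = 0"
  obtains g where "g \<in> poly_space (k - 1)" "\<And>y. f y = (e \<bullet> (y - z)) * g y"
proof (rule poly_space_factor_line[OF f e])
  show "f y = 0" if y: "e \<bullet> (y - z) = 0" for y
  proof -
    obtain t where "y - z = t *\<^sub>R w" using perpendicular_in_plane[OF e w y] .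
    then have "y = z + t *\<^sub>R w" by (simp add: algebra_simps)
    then show ?thesis using zero by simp
  qed
qed (use that in blast)

lemma poly_space_factor_twice:
  fixes e w z v :: "real^2"
  assumes f: "f \<in> poly_space k" and e: "e \<noteq> 0" and w: "w \<noteq> 0" "e \<bullet> w = 0"
    and v: "e \<bullet> v \<noteq> 0"
    and zero: "\<And>t. f (z + t *\<^sub>R w) = 0"
    and dzero: "\<And>t. dir_deriv v f (z + t *\<^sub>R w) = 0"
  obtains g where "g \<in> poly_space (k - 2)" "\<And>y. f y = (e \<bullet> (y - z)) ^ 2 * g y"
proof -
  obtain g where g: "g \<in> poly_space (k - 1)" "\<And>y. f y = (e \<bullet> (y - z)) * g y"
    using poly_space_factor[OF f e w zero] by blast
  have "f = (\<lambda>y. (e \<bullet> (y - z)) * g y)" using g(2) by auto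
  then have "dir_deriv v f = (\<lambda>y. (e \<bullet> (y - z)) * dir_deriv v g y + (e \<bullet> v) * g y)"
    using dir_deriv_mult[OF polynomial_map_intros(2) polynomial_mapI[OF g(1)], of v e z]
    by (simp only: dir_deriv_affine)
  then have "g (z + t *\<^sub>R w) = 0" for t
    using dzero[of t] v w by simp
  then obtain h where h: "h \<in> poly_space (k - 1 - 1)" "\<And>y. g y = (e \<bullet> (y - z)) * h y"
    using poly_space_factor[OF g(1) e w] by blast
  then show ?thesis using that[of h] g(2) by (simp add: power2_eq_square numeral_2_eq_2)
qed

lemma polynomial_map_continuous_on_line:
  "polynomial_map f \<Longrightarrow> continuous_on S (\<lambda>t. f (z + t *\<^sub>R w))"
  by (rule continuous_on_compose2[OF polynomial_map_continuous[of _ UNIV]])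
     (auto intro!: continuous_intros)

lemma continuous_zero_at_0:
  fixes h :: "real \<Rightarrow> real"
  assumes "continuous_on UNIV h" "\<And>t. t \<noteq> 0 \<Longrightarrow> h t = 0"
  shows "h 0 = 0"
proof -
  have "(h \<longlongrightarrow> h 0) (at 0)" using assms(1) by (simp add: continuous_on_def)
  moreover have "(h \<longlongrightarrow> 0) (at 0)"
    using assms(2) by (intro tendsto_eventually) (simp add: eventually_at_filter)
  ultimately show ?thesis using tendsto_unique trivial_limit_at by blast
qed

text \<open>
  The direction \<open>v\<close> is chosen so that the first linear form is constant along it: differentiating
  by \<open>v\<close> lowers the order of vanishing at \<open>z\<close> only for the second power. The square on the right
  keeps the derivative zero along the third line, with direction \<open>w\<close>, where dividing by \<open>t ^ (l - 1)\<close>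
  and letting \<open>t\<close> tend to \<open>0\<close> isolates \<open>q2 z\<close>.
\<close>

lemma square_divides_power_combination:
  fixes e1 e2 e3 v w z :: "real^2"
  assumes q: "polynomial_map q1" "polynomial_map q2" "polynomial_map r" and l: "l > 0"
    and eq: "\<And>y. (e1 \<bullet> (y - z)) ^ l * q1 y - (e2 \<bullet> (y - z)) ^ l * q2 y = (e3 \<bullet> (y - z)) ^ 2 * r y"
    and w: "e3 \<bullet> w = 0" "e2 \<bullet> w \<noteq> 0"
    and v: "e1 \<bullet> v = 0" "e2 \<bullet> v \<noteq> 0"
  shows "q2 z = 0"
proof -
  obtain m where m: "l = Suc m" using l by (cases l) auto
  have pw: "polynomial_map (\<lambda>y. (e \<bullet> (y - z)) ^ n)" for e n
    by (intro polynomial_map_intros)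
  have D: "dir_deriv v (\<lambda>y. (e \<bullet> (y - z)) ^ n * g y)
      = (\<lambda>y. (e \<bullet> (y - z)) ^ n * dir_deriv v g y
             + (real n * (e \<bullet> (y - z)) ^ (n - 1) * (e \<bullet> v)) * g y)"
    if "polynomial_map g" for e n g
    using dir_deriv_mult[OF pw that] dir_deriv_power[OF polynomial_map_intros(2)]
    by (simp only: dir_deriv_affine)
  define h where "h t = t * ((e1 \<bullet> w) ^ l * dir_deriv v q1 (z + t *\<^sub>R w)
      - (e2 \<bullet> w) ^ l * dir_deriv v q2 (z + t *\<^sub>R w))
      - real l * (e2 \<bullet> w) ^ m * (e2 \<bullet> v) * q2 (z + t *\<^sub>R w)" for t
  have h0: "h t = 0" if "t \<noteq> 0" for t
  proof -
    have "dir_deriv v (\<lambda>y. (e1 \<bullet> (y - z)) ^ l * q1 y - (e2 \<bullet> (y - z)) ^ l * q2 y) (z + t *\<^sub>R w)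
        = dir_deriv v (\<lambda>y. (e3 \<bullet> (y - z)) ^ 2 * r y) (z + t *\<^sub>R w)"
      using eq by simp
    then have "(t * (e1 \<bullet> w)) ^ l * dir_deriv v q1 (z + t *\<^sub>R w)
        - ((t * (e2 \<bullet> w)) ^ l * dir_deriv v q2 (z + t *\<^sub>R w)
          + real l * (t * (e2 \<bullet> w)) ^ m * (e2 \<bullet> v) * q2 (z + t *\<^sub>R w)) = 0"
      unfolding dir_deriv_diff[OF polynomial_map_intros(5)[OF pw q(1)] polynomial_map_intros(5)[OF pw q(2)]]
        D[OF q(1)] D[OF q(2)] D[OF q(3)]
      by (simp add: w v m)
    then have "t ^ m * h t = 0"
      by (simp add: h_def m power_mult_distrib algebra_simps)
    then show ?thesis using that by simp
  qed
  have "continuous_on UNIV h"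
    unfolding h_def using q
    by (intro continuous_intros polynomial_map_continuous_on_line polynomial_map_dir_deriv)
  then have "h 0 = 0" using h0 by (rule continuous_zero_at_0)
  then show ?thesis using w v l by (simp add: h_def)
qed

section \<open>Square linear systems\<close>

text \<open>
  Gaussian elimination: triviality of the kernel provides an equation with a nonzero pivot in any
  given column, and it passes to the system with that column and that equation eliminated.
\<close>

lemma square_system_solvable:
  fixes M :: "'j \<Rightarrow> 'i \<Rightarrow> real"
  assumes "finite I" "finite J" "card I = card J"
    and "\<And>c. (\<And>j. j \<in> J \<Longrightarrow> (\<Sum>i\<in>I. c i * M j i) = 0) \<Longrightarrow> (\<forall>i\<in>I. c i = 0)"
  shows "\<exists>c. \<forall>j\<in>J. (\<Sum>i\<in>I. c i * M j i) = d j"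
  using assms
proof (induction "card J" arbitrary: I J M d)
  case 0
  then show ?case by simp
next
  case (Suc n)
  then obtain s where s: "s \<in> I" by (metis card.empty ex_in_conv nat.distinct(1))
  define I' where "I' = I - {s}"
  have I: "I = insert s I'" "s \<notin> I'" "finite I'" using s Suc.prems(1) by (auto simp: I'_def)
  have sumI: "(\<Sum>i\<in>I. g i) = g s + (\<Sum>i\<in>I'. g i)" for g :: "'i \<Rightarrow> real"
    using I by simp
  obtain p where p: "p \<in> J" "M p s \<noteq> 0"
  proof (rule ccontr)
    assume "\<not> thesis"
    with that have zero: "M j s = 0" if "j \<in> J" for j using that by blast
    have "(\<Sum>i\<in>I. (if i = s then 1 else 0) * M j i) = 0" if "j \<in> J" for j
      unfolding sumI using zero[OF that] I(2) by (auto intro!: sum.neutral)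
    from Suc.prems(4)[OF this] show False using s by auto
  qed
  \<comment> \<open>row \<open>j\<close> after subtracting the multiple of the pivot row \<open>p\<close> that clears column \<open>s\<close>\<close>
  define M' where "M' j i = M j i - M j s / M p s * M p i" for j i
  have elim: "(\<Sum>i\<in>I. c i * M j i) = (\<Sum>i\<in>I'. c i * M' j i) + M j s / M p s * (\<Sum>i\<in>I. c i * M p i)"
    for c j
  proof -
    have "(\<Sum>i\<in>I'. c i * M' j i) = (\<Sum>i\<in>I'. c i * M j i) - M j s / M p s * (\<Sum>i\<in>I'. c i * M p i)"
      by (simp add: M'_def right_diff_distrib sum_subtractf sum_distrib_left mult_ac)
    then show ?thesis using p(2) unfolding sumI by (simp add: field_simps)
  qed
  define pivot where "pivot r c i = (if i = s then (r - (\<Sum>i\<in>I'. c i * M p i)) / M p s else c i)"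
    for r c and i :: 'i
  have pivot': "(\<Sum>i\<in>I'. pivot r c i * N i) = (\<Sum>i\<in>I'. c i * N i)" for r c N
    using I(2) by (intro sum.cong) (auto simp: pivot_def)
  have pivot_p: "(\<Sum>i\<in>I. pivot r c i * M p i) = r" for r c
    unfolding sumI pivot' using p(2) by (simp add: pivot_def)
  have "\<exists>c. \<forall>j\<in>J - {p}. (\<Sum>i\<in>I'. c i * M' j i) = d j - M j s / M p s * d p"
  proof (rule Suc.hyps(1))
    show "n = card (J - {p})" "finite I'" "finite (J - {p})" "card I' = card (J - {p})"
      using Suc.hyps(2) Suc.prems I p(1) by auto
    show "\<forall>i\<in>I'. c i = 0"
      if c: "\<And>j. j \<in> J - {p} \<Longrightarrow> (\<Sum>i\<in>I'. c i * M' j i) = 0" for c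
    proof -
      have "(\<Sum>i\<in>I. pivot 0 c i * M j i) = 0" if "j \<in> J" for j
        using c[of j] that pivot_p[of 0 c] elim[of "pivot 0 c" j] by (cases "j = p") (auto simp: pivot')
      from Suc.prems(4)[OF this] show ?thesis using I by (auto simp: pivot_def split: if_splits)
    qed
  qed
  then obtain c where c: "\<And>j. j \<in> J - {p} \<Longrightarrow>
    (\<Sum>i\<in>I'. c i * M' j i) = d j - M j s / M p s * d p" by blast
  have "(\<Sum>i\<in>I. pivot (d p) c i * M j i) = d j" if "j \<in> J" for j
    using c[of j] that pivot_p[of "d p" c] elim[of "pivot (d p) c" j]
    by (cases "j = p") (auto simp: pivot')
  then show ?case by blast
qed


section \<open>Continuously differentiable functions\<close>

lemma C1_on_add:
  assumes "C1_on S f" "C1_on S g"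
  shows "C1_on S (\<lambda>y. f y + g y)"
proof -
  obtain f' g' where "continuous_on S f'" "continuous_on S g'"
    "\<And>y. y \<in> S \<Longrightarrow> (f has_derivative (\<lambda>h. f' y \<bullet> h)) (at y within S)"
    "\<And>y. y \<in> S \<Longrightarrow> (g has_derivative (\<lambda>h. g' y \<bullet> h)) (at y within S)"
    using assms unfolding C1_on_def by blast
  then show ?thesis unfolding C1_on_def
    by (intro exI[where x="\<lambda>y. f' y + g' y"])
       (auto intro!: continuous_intros derivative_eq_intros simp: inner_add_left)
qed

lemma C1_on_mult:
  assumes "C1_on S f" "C1_on S g"
  shows "C1_on S (\<lambda>y. f y * g y)"
proof -
  obtain f' g' where f': "continuous_on S f'"
      "\<And>y. y \<in> S \<Longrightarrow> (f has_derivative (\<lambda>h. f' y \<bullet> h)) (at y within S)"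
    and g': "continuous_on S g'"
      "\<And>y. y \<in> S \<Longrightarrow> (g has_derivative (\<lambda>h. g' y \<bullet> h)) (at y within S)"
    using assms unfolding C1_on_def by blast
  have "continuous_on S f" "continuous_on S g"
    using f'(2) g'(2) has_derivative_continuous continuous_on_eq_continuous_within by blast+
  with f' g' show ?thesis unfolding C1_on_def
    by (intro exI[where x="\<lambda>y. f y *\<^sub>R g' y + g y *\<^sub>R f' y"])
       (auto intro!: continuous_intros derivative_eq_intros simp: inner_add_left algebra_simps)
qed

lemma C1_on_polynomial_map:
  assumes "polynomial_map f"
  shows "C1_on S f"
proof -
  obtain k where "f \<in> poly_space k" using assms by (auto simp: polynomial_map_def)
  then obtain g where g: "\<forall>i. (\<lambda>y. g y $ i) \<in> poly_space (k - 1)"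
    "\<forall>y. (f has_derivative (\<lambda>h. g y \<bullet> h)) (at y)"
    using poly_space_has_gradient by blast
  have "continuous_on S (\<lambda>y. g y $ i)" for i
    using g(1) by (intro polynomial_map_continuous) (auto intro: polynomial_mapI)
  then have "continuous_on S (\<lambda>y. \<chi> i. g y $ i)" by (rule continuous_on_vec_lambda)
  then show ?thesis using g(2) unfolding C1_on_def
    by (intro exI[of _ g]) (auto intro: has_derivative_at_withinI)
qed

lemma pos_part_square_has_derivative:
  "((\<lambda>s::real. (max s 0)\<^sup>2) has_real_derivative 2 * max s 0) (at s)"
proof -
  have bound: "\<bar>(max (s + h) 0)\<^sup>2 - (max s 0)\<^sup>2 - 2 * max s 0 * h\<bar> \<le> h\<^sup>2" for h
  proof -
    consider "s \<ge> 0" "s + h \<ge> 0" | "s \<ge> 0" "\<not> s + h \<ge> 0" | "\<not> s \<ge> 0" "s + h \<ge> 0"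
      | "\<not> s \<ge> 0" "\<not> s + h \<ge> 0" by blast
    then show ?thesis
    proof cases
      case 1
      then have "(max (s + h) 0)\<^sup>2 - (max s 0)\<^sup>2 - 2 * max s 0 * h = h\<^sup>2"
        by (simp add: max_def power2_eq_square algebra_simps)
      then show ?thesis by simp
    next
      case 2
      then have "0 \<le> s * - (s + 2 * h)" by (intro mult_nonneg_nonneg) auto
      moreover have "s * - (s + 2 * h) = h\<^sup>2 - (s + h)\<^sup>2"
        by (simp add: power2_eq_square algebra_simps)
      moreover have "(max (s + h) 0)\<^sup>2 - (max s 0)\<^sup>2 - 2 * max s 0 * h = s * - (s + 2 * h)"
        using 2 by (simp add: max_def power2_eq_square algebra_simps)
      ultimately show ?thesis using zero_le_power2[of "s + h"] by linarith
    next
      case 3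
      then have "(s + h)\<^sup>2 \<le> h\<^sup>2" by (intro power_mono) auto
      then show ?thesis using 3 by (simp add: max_def)
    next
      case 4
      then show ?thesis by (simp add: max_def)
    qed
  qed
  have quot: "\<bar>((max (s + h) 0)\<^sup>2 - (max s 0)\<^sup>2) / h - 2 * max s 0\<bar> \<le> \<bar>h\<bar>" if "h \<noteq> 0" for h
  proof -
    have "((max (s + h) 0)\<^sup>2 - (max s 0)\<^sup>2) / h - 2 * max s 0
        = ((max (s + h) 0)\<^sup>2 - (max s 0)\<^sup>2 - 2 * max s 0 * h) / h"
      using that by (simp add: diff_divide_distrib)
    moreover have "h\<^sup>2 = \<bar>h\<bar> * \<bar>h\<bar>" by (simp add: power2_eq_square)
    ultimately show ?thesis using bound[of h] that
      by (simp only: abs_divide) (simp only: divide_le_eq zero_less_abs_iff if_True simp_thms)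
  qed
  have "((\<lambda>h. ((max (s + h) 0)\<^sup>2 - (max s 0)\<^sup>2) / h - 2 * max s 0) \<longlongrightarrow> 0) (at 0)"
  proof (rule Lim_null_comparison[where g="\<lambda>h. \<bar>h\<bar>", rotated])
    show "((\<lambda>h::real. \<bar>h\<bar>) \<longlongrightarrow> 0) (at 0)" using tendsto_rabs_zero[OF tendsto_ident_at] .
    show "eventually (\<lambda>h. norm (((max (s + h) 0)\<^sup>2 - (max s 0)\<^sup>2) / h - 2 * max s 0) \<le> \<bar>h\<bar>) (at 0)"
      unfolding eventually_at_filter real_norm_def by (rule always_eventually) (use quot in blast)
  qed
  then show ?thesis unfolding DERIV_def by (rule Lim_null[THEN iffD2])
qed

lemma C1_on_pos_part_square:
  fixes e z :: "real^2"
  shows "C1_on S (\<lambda>y. (max (e \<bullet> (y - z)) 0)\<^sup>2)"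
proof -
  have "((\<lambda>y. (max (e \<bullet> (y - z)) 0)\<^sup>2) has_derivative
      (\<lambda>h. ((2 * max (e \<bullet> (y - z)) 0) *\<^sub>R e) \<bullet> h)) (at y within S)" for y
  proof -
    have "((\<lambda>y. e \<bullet> (y - z)) has_derivative (\<lambda>h. e \<bullet> h)) (at y within S)"
      by (auto intro!: derivative_eq_intros)
    from has_derivative_compose[OF this
        pos_part_square_has_derivative[unfolded has_field_derivative_def]]
    show ?thesis by simp
  qed
  then show ?thesis unfolding C1_on_def
    by (intro exI[where x="\<lambda>y. (2 * max (e \<bullet> (y - z)) 0) *\<^sub>R e"] conjI ballI)
       (auto intro!: continuous_intros simp del: inner_scaleR_left)
qed

section \<open>The quadrilateral and its diagonals\<close>

lemma index_4_arith:
  "(5::4) = 1" "(6::4) = 2" "(7::4) = 3" "(4::4) = 0" "(1::4) - 1 = 4"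
  by simp_all

locale crossed_quadrilateral =
  fixes x :: "4 \<Rightarrow> real^2" and x0 :: "real^2"
  assumes convex: "convex_quadrilateral x"
    and diagonal13: "x0 \<in> closed_segment (x 1) (x 3)"
    and diagonal24: "x0 \<in> closed_segment (x 2) (x 4)"
begin

lemma diagonal: "x0 \<in> closed_segment (x i) (x (i + 2))"
  using exhaust_4[of i] diagonal13 diagonal24
  by (auto simp: closed_segment_commute index_4_arith)

lemma side:
  obtains a b where "a \<bullet> x i = b" "a \<bullet> x (i + 1) = b" "a \<bullet> x (i + 2) < b" "a \<bullet> x (i + 3) < b"
    "a \<bullet> x0 < b"
proof -
  obtain a b where ab: "a \<bullet> x i = b" "a \<bullet> x (i + 1) = b" "a \<bullet> x (i + 2) < b" "a \<bullet> x (i + 3) < b"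
    using convex unfolding convex_quadrilateral_def by blast
  obtain a' b' where "a' \<bullet> x (i + 1) = b'" "a' \<bullet> x (i + 1 + 3) < b'"
    using convex unfolding convex_quadrilateral_def by blast
  moreover have "i + 1 + 3 = i" by (simp add: add.assoc)
  ultimately have ne: "x i \<noteq> x (i + 1)" by auto
  obtain s where s: "0 \<le> s" "x0 = (1 - s) *\<^sub>R x i + s *\<^sub>R x (i + 2)"
    using diagonal by (auto simp: closed_segment_def)
  obtain t where t: "0 \<le> t" "x0 = (1 - t) *\<^sub>R x (i + 1) + t *\<^sub>R x (i + 3)"
    using diagonal[of "i + 1"] by (auto simp: closed_segment_def add.commute)
  have "s > 0 \<or> t > 0" 
  proof (rule ccontr)
    assume "\<not> (s > 0 \<or> t > 0)"
    with s(1) t(1) have "s = 0" "t = 0" by auto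
    from s(2) \<open>s = 0\<close> have "x0 = x i" by simp
    moreover from t(2) \<open>t = 0\<close> have "x0 = x (i + 1)" by simp
    ultimately show False using ne by metis
  qed
  moreover have "b - a \<bullet> x0 = s * (b - a \<bullet> x (i + 2))"
    using ab(1) by (subst s(2)) (simp add: inner_add_right algebra_simps)
  moreover have "b - a \<bullet> x0 = t * (b - a \<bullet> x (i + 3))"
    using ab(2) by (subst t(2)) (simp add: inner_add_right algebra_simps)
  ultimately have "b - a \<bullet> x0 > 0" using ab by (metis diff_gt_0_iff_gt mult_pos_pos)
  then show ?thesis using that[of a b] ab by simp
qed

lemma centre_neq_vertex: "x0 \<noteq> x i"
  using side[of i] by (metis less_irrefl)

lemma adjacent_vertices_neq: "x i \<noteq> x (i + 1)"
proof -
  have "i + 1 + 3 = i" by (simp add: add.assoc)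
  then show ?thesis using side[of "i + 1"] by (metis less_irrefl)
qed

text \<open>
  In the plane, any normal of a side is a multiple of the supporting functional given by convexity,
  which is strict at the remaining vertices and at the centre.
\<close>

lemma side_normal:
  assumes "e \<noteq> 0" "e \<bullet> (x (i + 1) - x i) = 0"
  shows "e \<bullet> (x (i + 2) - x i) \<noteq> 0" "e \<bullet> (x (i + 3) - x i) \<noteq> 0" "e \<bullet> (x0 - x i) \<noteq> 0"
proof -
  obtain a b where a: "a \<bullet> x i = b" "a \<bullet> x (i + 1) = b" "a \<bullet> x (i + 2) < b" "a \<bullet> x (i + 3) < b"
    "a \<bullet> x0 < b" using side .
  have "x (i + 1) - x i \<noteq> 0" "a \<noteq> 0" using adjacent_vertices_neq[of i] a by auto
  moreover have "(x (i + 1) - x i) \<bullet> a = 0" "(x (i + 1) - x i) \<bullet> e = 0"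
    using assms(2) a by (simp_all add: inner_commute inner_diff_right)
  ultimately obtain t where t: "e = t *\<^sub>R a" using perpendicular_in_plane by blast
  with assms(1) have "t \<noteq> 0" by auto
  then show "e \<bullet> (x (i + 2) - x i) \<noteq> 0" "e \<bullet> (x (i + 3) - x i) \<noteq> 0" "e \<bullet> (x0 - x i) \<noteq> 0"
    using a t by (auto simp: inner_diff_right)
qed

lemma opposite_vertex:
  obtains c where "c > 0" "x (i + 2) - x0 = - c *\<^sub>R (x i - x0)"
proof -
  obtain s where s: "0 \<le> s" "s \<le> 1" "x0 = (1 - s) *\<^sub>R x i + s *\<^sub>R x (i + 2)"
    using diagonal by (auto simp: closed_segment_def)
  have "s \<noteq> 0" "s \<noteq> 1" using s(3) centre_neq_vertex[of i] centre_neq_vertex[of "i + 2"] by auto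
  with s have s01: "0 < s" "s < 1" by auto
  have "s *\<^sub>R (x (i + 2) - x0) = - (1 - s) *\<^sub>R (x i - x0)"
    using s(3) by (simp add: algebra_simps)
  also have "\<dots> = s *\<^sub>R (- ((1 - s) / s) *\<^sub>R (x i - x0))"
    using s01 by (simp add: scaleR_left_diff_distrib)
  finally have "x (i + 2) - x0 = - ((1 - s) / s) *\<^sub>R (x i - x0)"
    by (rule scaleR_left_imp_eq[OF \<open>s \<noteq> 0\<close>])
  then show ?thesis using that[of "(1 - s) / s"] s01 by simp
qed

text \<open>
  Otherwise the two adjacent vertices would lie on one line through the centre; as the functional
  supporting their side takes equal values at them, they would coincide.
\<close>

lemma diagonal_normal:
  assumes "e \<noteq> 0" "e \<bullet> (x i - x0) = 0"
  shows "e \<bullet> (x (i + 1) - x0) \<noteq> 0"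
proof
  assume "e \<bullet> (x (i + 1) - x0) = 0"
  moreover have "x i - x0 \<noteq> 0" using centre_neq_vertex[of i] by simp
  ultimately obtain t where t: "x (i + 1) - x0 = t *\<^sub>R (x i - x0)"
    using perpendicular_in_plane assms by blast
  obtain a b where a: "a \<bullet> x i = b" "a \<bullet> x (i + 1) = b" "a \<bullet> x0 < b" using side .
  have "a \<bullet> (x (i + 1) - x0) = t * (a \<bullet> (x i - x0))" using t by simp
  then have "t = 1" using a by (simp add: inner_diff_right)
  then show False using t adjacent_vertices_neq[of i] by simp
qed

lemma diagonal_normal_opposite:
  assumes "e \<bullet> (x i - x0) = 0"
  shows "e \<bullet> (x (i + 2) - x0) = 0"
proof -
  obtain c where "x (i + 2) - x0 = - c *\<^sub>R (x i - x0)" using opposite_vertex .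
  then show ?thesis using assms by simp
qed

lemma oriented_diagonal_normal:
  obtains e where "e \<noteq> 0" "e \<bullet> (x i - x0) = 0" "e \<bullet> (x (i + 1) - x0) > 0"
    "e \<bullet> (x (i + 2) - x0) = 0" "e \<bullet> (x (i + 3) - x0) < 0"
proof -
  define d where "d = x i - x0"
  define e' :: "real^2" where "e' = vector [- d $ 2, d $ 1]"
  have d: "d \<noteq> 0" using centre_neq_vertex[of i] by (simp add: d_def)
  have e': "e' \<bullet> d = 0" "e' \<noteq> 0"
    using d by (auto simp: e'_def inner_vec_def sum_2 vec_eq_iff forall_2 vector_2)
  define e where "e = (if e' \<bullet> (x (i + 1) - x0) > 0 then e' else - e')"
  have e: "e \<noteq> 0" "e \<bullet> (x i - x0) = 0" using e' by (auto simp: e_def d_def)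
  have pos: "e \<bullet> (x (i + 1) - x0) > 0"
    using diagonal_normal[OF e'(2), of i] e' by (auto simp: e_def d_def)
  have "i + 1 + 2 = i + 3" by (simp add: add.assoc)
  then obtain c where "c > 0" "x (i + 3) - x0 = - c *\<^sub>R (x (i + 1) - x0)"
    using opposite_vertex[of "i + 1"] by metis
  then show ?thesis using that[of e] e pos diagonal_normal_opposite[OF e(2)] by simp
qed

end


section \<open>Matching across the diagonals\<close>

lemma dir_deriv_zero_from_basis:
  assumes q: "polynomial_map q" and "a \<noteq> 0" "e \<bullet> a = 0" "e \<bullet> b \<noteq> 0"
    and zero: "dir_deriv a q y = 0" "dir_deriv b q y = 0"
  shows "dir_deriv v q y = 0"
proof -
  define s where "s = (e \<bullet> v) / (e \<bullet> b)"
  have "e \<noteq> 0" "e \<bullet> (v - s *\<^sub>R b) = 0" using assms(4) by (auto simp: s_def inner_diff_right)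
  then obtain t where "v - s *\<^sub>R b = t *\<^sub>R a"
    using perpendicular_in_plane assms(2,3) by blast
  then have "v = s *\<^sub>R b + t *\<^sub>R a" by (simp add: algebra_simps)
  then show ?thesis
    using zero linear_add[OF dir_deriv_linear[OF q]] linear_scale[OF dir_deriv_linear[OF q]] by simp
qed

lemma (in crossed_quadrilateral) diagonal_equations:
  obtains e f where "e \<noteq> 0" "e \<bullet> (x 1 - x0) = 0" "e \<bullet> (x 2 - x0) > 0"
    "e \<bullet> (x 3 - x0) = 0" "e \<bullet> (x 4 - x0) < 0"
    "f \<noteq> 0" "f \<bullet> (x 1 - x0) > 0" "f \<bullet> (x 2 - x0) = 0"
    "f \<bullet> (x 3 - x0) < 0" "f \<bullet> (x 4 - x0) = 0"
proof -
  have idx1: "1 + 1 = (2::4)" "1 + 2 = (3::4)" "1 + 3 = (4::4)" by simp_all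
  obtain e where e: "e \<noteq> 0" "e \<bullet> (x 1 - x0) = 0" "e \<bullet> (x 2 - x0) > 0"
    "e \<bullet> (x 3 - x0) = 0" "e \<bullet> (x 4 - x0) < 0"
    by (rule oriented_diagonal_normal[of 1, unfolded idx1])
  have idx2: "2 + 1 = (3::4)" "2 + 2 = (4::4)" "2 + 3 = (1::4)" by simp_all
  obtain f where f: "f \<noteq> 0" "f \<bullet> (x 2 - x0) = 0" "f \<bullet> (x 3 - x0) > 0"
    "f \<bullet> (x 4 - x0) = 0" "f \<bullet> (x 1 - x0) < 0"
    by (rule oriented_diagonal_normal[of 2, unfolded idx2])
  show ?thesis by (rule that[OF e, of "- f"]) (use f in simp_all)
qed

locale matched_pieces = crossed_quadrilateral +
  fixes k :: nat and \<nu> :: "real^2 \<Rightarrow> real^2 \<Rightarrow> real^2" and p :: "4 \<Rightarrow> real^2 \<Rightarrow> real"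
  assumes k: "k \<ge> 3"
    and normal: "\<And>a b. a \<noteq> b \<Longrightarrow> normal_direction (\<nu> a b) a b"
    and degree: "\<And>i. p i \<in> poly_space k"
    and matching: "\<And>\<gamma>. \<gamma> \<in> constraints k \<Longrightarrow> constr_value k x x0 \<nu> p \<gamma> = 0"
begin

definition jump :: "4 \<Rightarrow> real^2 \<Rightarrow> real" where
  "jump i = (\<lambda>y. p i y - p (i - 1) y)"

lemma jump_simps:
  "jump 1 y = p 1 y - p 4 y" "jump 2 y = p 2 y - p 1 y"
  "jump 3 y = p 3 y - p 2 y" "jump 4 y = p 4 y - p 3 y"
  "jump (i + 1) y = p (i + 1) y - p i y"
proof -
  have "(1::4) - 1 = 4" "(2::4) - 1 = 1" "(3::4) - 1 = 2" "(4::4) - 1 = 3" by simp_all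
  then show "jump 1 y = p 1 y - p 4 y" "jump 2 y = p 2 y - p 1 y"
    "jump 3 y = p 3 y - p 2 y" "jump 4 y = p 4 y - p 3 y"
    by (simp_all only: jump_def)
qed (simp add: jump_def)

lemma polynomial_map_p: "polynomial_map (p i)"
  using degree by (rule polynomial_mapI)

lemma jump_degree: "jump i \<in> poly_space k"
  unfolding jump_def by (intro poly_space_diff degree)

lemma polynomial_map_jump: "polynomial_map (jump i)"
  using jump_degree by (rule polynomial_mapI)

lemma jump_vertex: "jump i (x i) = 0" "dir_deriv v (jump i) (x i) = 0"
proof -
  show "jump i (x i) = 0"
    using matching[of "Match_Value i"] by (simp add: constraints_def jump_def)
  have "partial_x (jump i) (x i) = 0" "partial_y (jump i) (x i) = 0"
    using matching[of "Match_Dx i"] matching[of "Match_Dy i"] by (simp_all add: constraints_def jump_def)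
  then show "dir_deriv v (jump i) (x i) = 0"
    by (rule dir_deriv_zero_from_basis[OF polynomial_map_jump, rotated -2, where e="axis 2 1"])
       (simp_all add: axis_eq_0_iff inner_axis_axis)
qed

lemma jump_centre: "jump i x0 = 0" "dir_deriv v (jump i) x0 = 0"
proof -
  have V: "p j x0 = p 1 x0" for j
    using exhaust_4[of j] matching[of "Centre_Value j"] by (auto simp: constraints_def)
  from V[of i] V[of "i - 1"] show "jump i x0 = 0" by (simp add: jump_def)
  have D: "dir_deriv u (jump i) x0 = 0"
    if "\<And>j. j \<in> {2, 3, 4} \<Longrightarrow> dir_deriv u (\<lambda>y. p 1 y - p j y) x0 = 0" for u
  proof -
    have W: "dir_deriv u (p j) x0 = dir_deriv u (p 1) x0" for j
      using exhaust_4[of j] that[of j] by (auto simp: dir_deriv_diff polynomial_map_p)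
    from W[of i] W[of "i - 1"] show ?thesis by (simp add: jump_def dir_deriv_diff polynomial_map_p)
  qed
  have D24: "dir_deriv (\<nu> (x 2) (x 4)) (jump i) x0 = 0"
    by (rule D, use matching[of "Centre_Normal24 _"] in \<open>auto simp: constraints_def\<close>)
  have D13: "dir_deriv (\<nu> (x 1) (x 3)) (jump i) x0 = 0"
    by (rule D, use matching[of "Centre_Normal13 _"] in \<open>auto simp: constraints_def\<close>)
  obtain c where c: "c > 0" "x 3 - x0 = - c *\<^sub>R (x 1 - x0)" using opposite_vertex[of 1] by auto
  obtain c' where c': "c' > 0" "x 4 - x0 = - c' *\<^sub>R (x 2 - x0)" using opposite_vertex[of 2] by auto
  have d13: "x 3 - x 1 = - (1 + c) *\<^sub>R (x 1 - x0)" and d24: "x 4 - x 2 = - (1 + c') *\<^sub>R (x 2 - x0)"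
    using c(2) c'(2) by (simp_all add: algebra_simps)
  have "x 1 \<noteq> x 3" "x 2 \<noteq> x 4"
    using d13 d24 c(1) c'(1) centre_neq_vertex[of 1] centre_neq_vertex[of 2] by auto
  then have n13: "\<nu> (x 1) (x 3) \<noteq> 0" "\<nu> (x 1) (x 3) \<bullet> (x 3 - x 1) = 0"
    and n24: "\<nu> (x 2) (x 4) \<noteq> 0" "\<nu> (x 2) (x 4) \<bullet> (x 4 - x 2) = 0"
    using normal by (auto simp: normal_direction_def)
  have "\<nu> (x 1) (x 3) \<bullet> (x 1 - x0) = 0" using n13(2) c(1) unfolding d13 by simp
  from diagonal_normal[OF n13(1) this]
  have "\<nu> (x 1) (x 3) \<bullet> (x 2 - x0) \<noteq> 0" by simp
  then have "\<nu> (x 1) (x 3) \<bullet> (x 4 - x 2) \<noteq> 0" using c'(1) unfolding d24 by simp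
  then show "dir_deriv v (jump i) x0 = 0"
    by (intro dir_deriv_zero_from_basis[OF polynomial_map_jump n24(1) _ _ D24 D13, of "x 4 - x 2"])
       (use n24(2) in \<open>simp_all add: inner_commute\<close>)
qed

text \<open>
  The \<open>k - 1\<close> nodes of the edge, ends included, count \<open>k + 1\<close> zeros because both ends are double.
\<close>

lemma jump_on_edge: "jump i (x0 + t *\<^sub>R (x i - x0)) = 0"
proof (rule vanishes_on_segment_line[OF jump_degree, of "k - 2" "{0..k - 2}" "{0, k - 2}"])
  have m: "k - 2 > 0" using k by simp
  show "k - 2 > 0" by (fact m)
  show "jump i (segment_node (k - 2) j (x i) x0) = 0" if "j \<in> {0..k - 2}" for j
  proof -
    have "j = 0 \<or> j = k - 2 \<or> j \<in> {1..k - 3}" using that k by auto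
    then consider "j = 0" | "j = k - 2" | "j \<in> {1..k - 3}" by blast
    then show ?thesis
    proof cases
      case 3
      then show ?thesis using matching[of "Match_Edge_Value i j"]
        by (simp add: constraints_def jump_def Let_def)
    qed (simp_all add: segment_node_ends[OF m, simplified] jump_vertex jump_centre)
  qed
  show "dir_deriv (x i - x0) (jump i) (segment_node (k - 2) j (x i) x0) = 0" if "j \<in> {0, k - 2}" for j
    using that by (auto simp: segment_node_ends[OF m, simplified] jump_vertex jump_centre)
qed (use k in auto)

lemma edge_normal_parallel:
  assumes "e \<noteq> 0" "e \<bullet> (x i - x0) = 0"
  shows "e \<bullet> \<nu> x0 (x i) \<noteq> 0"
proof -
  have d: "x i - x0 \<noteq> 0" using centre_neq_vertex[of i] by simp
  have n: "\<nu> x0 (x i) \<noteq> 0" "(x i - x0) \<bullet> \<nu> x0 (x i) = 0"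
    using normal[OF centre_neq_vertex[of i]] by (auto simp: normal_direction_def inner_commute)
  have "(x i - x0) \<bullet> e = 0" using assms(2) by (simp add: inner_commute)
  then obtain t where "e = t *\<^sub>R \<nu> x0 (x i)"
    using perpendicular_in_plane[OF d n] by blast
  with assms(1) n(1) show ?thesis by auto
qed

text \<open>
  The nodes \<open>j = 0\<close> and \<open>j = k - 1\<close> are the centre and the vertex, where the whole gradient matches.
\<close>

lemma jump_normal_nodes:
  assumes "j \<in> {1..(if i = 3 then k - 3 else k - 2)} \<or> j = 0 \<or> j = k - 1"
  shows "dir_deriv (\<nu> x0 (x i)) (jump i) (segment_node (k - 1) j (x i) x0) = 0"
proof -
  have m: "k - 1 > 0" using k by simp
  show ?thesis
  proof (cases "j = 0 \<or> j = k - 1")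
    case True
    then show ?thesis by (auto simp: segment_node_ends[OF m, simplified] jump_vertex jump_centre)
  next
    case False
    with assms have "Match_Edge_Normal i j \<in> constraints k" by (auto simp: constraints_def)
    from matching[OF this] show ?thesis by (simp add: jump_def)
  qed
qed

lemma jump_divisible_by_square:
  assumes e: "e \<noteq> 0" "e \<bullet> (x i - x0) = 0" and i: "i \<noteq> 3"
  obtains r where "polynomial_map r" "\<And>y. jump i y = (e \<bullet> (y - x0)) ^ 2 * r y"
proof -
  have w: "x i - x0 \<noteq> 0" using centre_neq_vertex[of i] by simp
  have "dir_deriv (\<nu> x0 (x i)) (jump i) (x0 + t *\<^sub>R (x i - x0)) = 0" for t
  proof (rule vanishes_on_segment_line[OF dir_deriv_in_poly_space[OF jump_degree],
        of "k - 1" "{0..k - 1}" "{}"])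
    show "dir_deriv (\<nu> x0 (x i)) (jump i) (segment_node (k - 1) j (x i) x0) = 0"
      if "j \<in> {0..k - 1}" for j
      using that i by (intro jump_normal_nodes) auto
  qed (use k in auto)
  then obtain r where "r \<in> poly_space (k - 2)" "\<And>y. jump i y = (e \<bullet> (y - x0)) ^ 2 * r y"
    using poly_space_factor_twice[OF jump_degree e(1) w e(2) edge_normal_parallel[OF e] jump_on_edge]
    by blast
  then show ?thesis using that[of r] polynomial_mapI by blast
qed

text \<open>
  On the edge to \<open>x 3\<close> one normal node is missing. Let \<open>e\<close> and \<open>f\<close> be the equations of the two
  diagonals. The other jumps are \<open>e\<^sup>2 a\<close>, \<open>f\<^sup>2 b\<close> and \<open>f\<^sup>2 c\<close>, and the four sum to \<open>0\<close>, so
  \<open>jump 3 = - e\<^sup>2 a - f\<^sup>2 (b + c)\<close>. As \<open>jump 3\<close> vanishes where \<open>e\<close> does, \<open>e\<close> divides \<open>b + c\<close>; hence the normal derivative of \<open>jump 3\<close> is a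
  multiple of \<open>f\<^sup>2\<close> along the diagonal, and this double zero at the centre replaces the missing
  node.
\<close>

lemma pieces_from_squares:
  assumes e: "e \<noteq> 0" "e \<bullet> (x 1 - x0) = 0" and f: "f \<noteq> 0" "f \<bullet> (x 2 - x0) = 0"
  obtains a c g where "polynomial_map a" "polynomial_map c" "polynomial_map g"
    "\<And>y. p 4 y = p 3 y + (f \<bullet> (y - x0)) ^ 2 * c y"
    "\<And>y. p 2 y = p 3 y + (e \<bullet> (y - x0)) ^ 2 * (a y + (f \<bullet> (y - x0)) ^ 2 * g y)"
    "\<And>y. p 1 y = p 3 y + (f \<bullet> (y - x0)) ^ 2 * c y + (e \<bullet> (y - x0)) ^ 2 * a y"
proof -
  define w where "w = x 3 - x0"
  have w: "w \<noteq> 0" using centre_neq_vertex[of 3] by (simp add: w_def)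
  have e3: "e \<bullet> w = 0" using diagonal_normal_opposite[OF e(2)] by (simp add: w_def)
  have f4: "f \<bullet> (x 4 - x0) = 0" using diagonal_normal_opposite[OF f(2)] by simp
  have fw: "f \<bullet> w \<noteq> 0" using diagonal_normal[OF f] by (simp add: w_def)
  obtain a where a: "polynomial_map a" "\<And>y. jump 1 y = (e \<bullet> (y - x0)) ^ 2 * a y"
    using jump_divisible_by_square[OF e] by auto
  obtain b where b: "polynomial_map b" "\<And>y. jump 2 y = (f \<bullet> (y - x0)) ^ 2 * b y"
    using jump_divisible_by_square[OF f] by auto
  obtain c where c: "polynomial_map c" "\<And>y. jump 4 y = (f \<bullet> (y - x0)) ^ 2 * c y"
    using jump_divisible_by_square[OF f(1) f4] by auto
  have jump3: "jump 3 y = - ((e \<bullet> (y - x0)) ^ 2 * a y) - (f \<bullet> (y - x0)) ^ 2 * (b y + c y)" for y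
    using a(2)[of y] b(2)[of y] c(2)[of y] by (simp add: jump_simps algebra_simps)
  \<comment> \<open>Dividing by powers of \<open>t\<close> below loses the centre \<open>t = 0\<close>; continuity recovers it.\<close>
  have zero_on_line: "h (x0 + t *\<^sub>R w) = 0"
    if h: "polynomial_map h" "\<And>t. t \<noteq> 0 \<Longrightarrow> h (x0 + t *\<^sub>R w) = 0" for h t
    using continuous_zero_at_0[OF polynomial_map_continuous_on_line[OF h(1)], of x0 w] h(2)
    by (cases "t = 0") auto
  have divisible: "\<exists>g. polynomial_map g \<and> (\<forall>y. h y = (e \<bullet> (y - x0)) * g y)"
    if h: "polynomial_map h" "\<And>t. t \<noteq> 0 \<Longrightarrow> h (x0 + t *\<^sub>R w) = 0" for h
  proof -
    obtain m where m: "h \<in> poly_space m" using h(1) by (auto simp: polynomial_map_def)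
    have "h (x0 + t *\<^sub>R w) = 0" for t using h by (rule zero_on_line)
    then obtain g where "g \<in> poly_space (m - 1)" "\<And>y. h y = (e \<bullet> (y - x0)) * g y"
      using poly_space_factor[OF m e(1) w e3] by blast
    then show ?thesis using polynomial_mapI by blast
  qed
  have "b (x0 + t *\<^sub>R w) + c (x0 + t *\<^sub>R w) = 0" if "t \<noteq> 0" for t
    using jump3[of "x0 + t *\<^sub>R w"] jump_on_edge[of 3 t] e3 fw that by (simp flip: w_def)
  then obtain g1 where g1: "polynomial_map g1" "\<And>y. b y + c y = (e \<bullet> (y - x0)) * g1 y"
    using divisible[of "\<lambda>y. b y + c y"] b(1) c(1) by blast
  define v where "v = \<nu> x0 (x 3)"
  have ev: "e \<bullet> v \<noteq> 0" using edge_normal_parallel[OF e(1), of 3] e3 by (simp add: v_def w_def)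
  have sq: "polynomial_map (\<lambda>y. (u \<bullet> (y - x0)) ^ 2)" for u
    by (intro polynomial_map_intros)
  have normal_derivative: "dir_deriv v (jump 3) (x0 + t *\<^sub>R w)
      = t\<^sup>2 * (- ((f \<bullet> w)\<^sup>2 * (e \<bullet> v)) * g1 (x0 + t *\<^sub>R w))" for t
  proof -
    define h where "h y = - a y * (e \<bullet> (y - x0)) - (f \<bullet> (y - x0)) ^ 2 * g1 y" for y
    have h: "polynomial_map h"
      using polynomial_map_intros(5)[OF polynomial_map_intros(1)[of "-1"] a(1)]
      unfolding h_def[abs_def] by (intro polynomial_map_intros sq g1) simp
    have "jump 3 = (\<lambda>y. (e \<bullet> (y - x0)) * h y)"
      by (simp only: fun_eq_iff jump3 g1(2) h_def) (simp add: power2_eq_square algebra_simps)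
    then have "dir_deriv v (jump 3) = (\<lambda>y. (e \<bullet> (y - x0)) * dir_deriv v h y + (e \<bullet> v) * h y)"
      by (simp only: dir_deriv_mult[OF polynomial_map_intros(2) h] dir_deriv_affine)
    then show ?thesis using e3 by (simp add: h_def power_mult_distrib)
  qed
  have "dir_deriv v (jump 3) (x0 + t *\<^sub>R w) = 0" for t
    unfolding w_def
  proof (rule vanishes_on_segment_line[OF dir_deriv_in_poly_space[OF jump_degree],
        of "k - 1" "{0..k - 3} \<union> {k - 1}" "{0}"])
    have m: "k - 1 > 0" using k by simp
    show "dir_deriv v (jump 3) (segment_node (k - 1) j (x 3) x0) = 0"
      if "j \<in> {0..k - 3} \<union> {k - 1}" for j
      unfolding v_def using that by (intro jump_normal_nodes) auto
    have "dir_deriv w (dir_deriv v (jump 3)) x0 = 0"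
    proof -
      obtain m where "g1 \<in> poly_space m" using g1(1) by (auto simp: polynomial_map_def)
      then obtain G where G: "\<And>t. g1 (x0 + t *\<^sub>R w) = poly G t" using poly_space_on_line by blast
      define C where "C = - ((f \<bullet> w)\<^sup>2 * (e \<bullet> v))"
      have "((\<lambda>t. t\<^sup>2 * (C * poly G t)) has_real_derivative 0) (at 0)"
        by (rule derivative_eq_intros poly_DERIV refl | simp)+
      moreover have "(\<lambda>t. dir_deriv v (jump 3) (x0 + t *\<^sub>R w)) = (\<lambda>t. t\<^sup>2 * (C * poly G t))"
        by (simp add: normal_derivative G C_def)
      ultimately show ?thesis
        unfolding dir_deriv_def[of w] by (simp add: DERIV_imp_deriv)
    qed
    then show "dir_deriv (x 3 - x0) (dir_deriv v (jump 3)) (segment_node (k - 1) j (x 3) x0) = 0"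
      if "j \<in> {0}" for j
      using that by (simp add: segment_node_ends[OF m, simplified] w_def)
    have "card ({0..k - 3} \<union> {k - 1}) = Suc (card {0..k - 3})"
      using k by simp
    then show "k - 1 < card ({0..k - 3} \<union> {k - 1}) + card {0 :: nat}" using k by simp
  qed (use k in auto)
  then have "g1 (x0 + t *\<^sub>R w) = 0" if "t \<noteq> 0" for t
    using normal_derivative[of t] that fw ev by simp
  then obtain g where g: "polynomial_map g" "\<And>y. g1 y = (e \<bullet> (y - x0)) * g y"
    using divisible[OF g1(1)] by blast
  show ?thesis
  proof (rule that[OF a(1) c(1) g(1)])
    show "p 4 y = p 3 y + (f \<bullet> (y - x0)) ^ 2 * c y" for y
      using c(2)[of y] by (simp add: jump_simps)
    show "p 2 y = p 3 y + (e \<bullet> (y - x0)) ^ 2 * (a y + (f \<bullet> (y - x0)) ^ 2 * g y)" for y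
      using jump3[of y] unfolding g1(2) g(2) jump_simps
      by (simp only: power2_eq_square) algebra
    show "p 1 y = p 3 y + (f \<bullet> (y - x0)) ^ 2 * c y + (e \<bullet> (y - x0)) ^ 2 * a y" for y
      using a(2)[of y] c(2)[of y] by (simp add: jump_simps)
  qed
qed

lemma jump_square:
  obtains e r where "polynomial_map r" "e \<bullet> (x i - x0) = 0"
    "\<And>y. jump i y = (e \<bullet> (y - x0)) ^ 2 * r y"
proof (cases "i = 3")
  case True
  obtain e f where e: "e \<noteq> 0" "e \<bullet> (x 1 - x0) = 0" "e \<bullet> (x 3 - x0) = 0"
    and f: "f \<noteq> 0" "f \<bullet> (x 2 - x0) = 0"
    by (rule diagonal_equations) (rule that)
  obtain a c g where ag: "polynomial_map a" "polynomial_map g"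
    and p2: "\<And>y. p 2 y = p 3 y + (e \<bullet> (y - x0)) ^ 2 * (a y + (f \<bullet> (y - x0)) ^ 2 * g y)"
    by (rule pieces_from_squares[OF e(1,2) f]) (rule that)
  show ?thesis
  proof (rule that[of "\<lambda>y. (-1) * (a y + (f \<bullet> (y - x0)) ^ 2 * g y)" e])
    show "polynomial_map (\<lambda>y. (-1) * (a y + (f \<bullet> (y - x0)) ^ 2 * g y))"
      by (intro polynomial_map_intros ag)
    show "e \<bullet> (x i - x0) = 0" using e True by simp
    show "jump i y = (e \<bullet> (y - x0))\<^sup>2 * (-1 * (a y + (f \<bullet> (y - x0))\<^sup>2 * g y))" for y
      unfolding True jump_simps p2 by (simp add: distrib_left right_diff_distrib)
  qed
next
  case False
  obtain e where e: "e \<noteq> 0" "e \<bullet> (x i - x0) = 0" by (rule oriented_diagonal_normal[of i])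
  obtain r where "polynomial_map r" "\<And>y. jump i y = (e \<bullet> (y - x0)) ^ 2 * r y"
    by (rule jump_divisible_by_square[OF e False]) (rule that)
  then show ?thesis using that[of r e] e(2) by blast
qed

lemma subtriangle_nonneg:
  assumes "e \<bullet> (x i - x0) \<ge> 0" "e \<bullet> (x (i + 1) - x0) \<ge> 0" "y \<in> subtriangle x x0 i"
  shows "e \<bullet> (y - x0) \<ge> 0"
proof -
  have "subtriangle x x0 i \<subseteq> {y. e \<bullet> y \<ge> e \<bullet> x0}"
    unfolding subtriangle_def using assms(1,2)
    by (intro hull_minimal convex_halfspace_ge) (auto simp: inner_diff_right)
  then show ?thesis using assms(3) by (auto simp: inner_diff_right)
qed

text \<open>
  The four quadrants cut out by the diagonals are distinguished by the signs of \<open>e\<close> and \<open>f\<close>, so the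
  representation of the pieces turns into one formula in the positive parts of \<open>\<plusminus>e\<close> and \<open>\<plusminus>f\<close>,
  whose squares are continuously differentiable on the whole plane.
\<close>

lemma piecewise_C1:
  "\<exists>F. (\<forall>i. \<forall>y \<in> subtriangle x x0 i. F y = p i y) \<and> C1_on (quad x) F"
proof -
  obtain e f where e: "e \<noteq> 0" "e \<bullet> (x 1 - x0) = 0" "e \<bullet> (x 2 - x0) > 0"
    "e \<bullet> (x 3 - x0) = 0" "e \<bullet> (x 4 - x0) < 0"
    and f: "f \<noteq> 0" "f \<bullet> (x 1 - x0) > 0" "f \<bullet> (x 2 - x0) = 0"
    "f \<bullet> (x 3 - x0) < 0" "f \<bullet> (x 4 - x0) = 0"
    by (rule diagonal_equations)
  obtain a c g where acg: "polynomial_map a" "polynomial_map c" "polynomial_map g"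
    and p4: "\<And>y. p 4 y = p 3 y + (f \<bullet> (y - x0)) ^ 2 * c y"
    and p2: "\<And>y. p 2 y = p 3 y + (e \<bullet> (y - x0)) ^ 2 * (a y + (f \<bullet> (y - x0)) ^ 2 * g y)"
    and p1: "\<And>y. p 1 y = p 3 y + (f \<bullet> (y - x0)) ^ 2 * c y + (e \<bullet> (y - x0)) ^ 2 * a y"
    by (rule pieces_from_squares[OF e(1,2) f(1,3)]) (rule that)
  define F where "F y = p 3 y + (max (f \<bullet> (y - x0)) 0)\<^sup>2 * c y
    + (max (e \<bullet> (y - x0)) 0)\<^sup>2 * (a y + (max ((- f) \<bullet> (y - x0)) 0)\<^sup>2 * g y)" for y
  have "C1_on (quad x) F"
    unfolding F_def[abs_def]
    by (intro C1_on_add C1_on_mult C1_on_polynomial_map C1_on_pos_part_square acg polynomial_map_p)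
  moreover have "F y = p i y" if y: "y \<in> subtriangle x x0 i" for i y
  proof -
    have nonneg: "u \<bullet> (y - x0) \<ge> 0" if "u \<bullet> (x i - x0) \<ge> 0" "u \<bullet> (x (i + 1) - x0) \<ge> 0" for u
      by (rule subtriangle_nonneg[OF that y])
    consider "i = 1" | "i = 2" | "i = 3" | "i = 4" using exhaust_4[of i] by blast
    then show ?thesis
    proof cases
      case 1
      have "e \<bullet> (y - x0) \<ge> 0" "f \<bullet> (y - x0) \<ge> 0"
        using e f nonneg[of e] nonneg[of f] by (simp_all add: 1)
      then show ?thesis by (simp add: F_def 1 p1)
    next
      case 2
      have "e \<bullet> (y - x0) \<ge> 0" "(- f) \<bullet> (y - x0) \<ge> 0"
        using e f nonneg[of e] nonneg[of "- f"] by (simp_all add: 2)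
      then show ?thesis by (simp add: F_def 2 p2)
    next
      case 3
      have "(- e) \<bullet> (y - x0) \<ge> 0" "(- f) \<bullet> (y - x0) \<ge> 0"
        using e f nonneg[of "- e"] nonneg[of "- f"] by (simp_all add: 3)
      then show ?thesis by (simp add: F_def 3)
    next
      case 4
      have "(- e) \<bullet> (y - x0) \<ge> 0" "f \<bullet> (y - x0) \<ge> 0"
        using e f nonneg[of "- e"] nonneg[of f] by (simp_all add: 4 index_4_arith(1))
      then show ?thesis by (simp add: F_def 4 p4)
    qed
  qed
  ultimately show ?thesis by blast
qed

end

section \<open>Vanishing degrees of freedom\<close>

locale matched_pieces_zero_data = matched_pieces +
  fixes n :: "4 \<Rightarrow> real^2"
  assumes n_neq_0: "\<And>i. n i \<noteq> 0"
    and n_normal: "\<And>i. n i \<bullet> (x (i + 1) - x i) = 0"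
    and data: "\<And>\<delta>. \<delta> \<in> dofs k \<Longrightarrow> dof_value k x n p \<delta> = 0"
begin

lemma on_side:
  "n i \<bullet> (x i - x (i + 1)) = 0" "n i \<bullet> (y - x (i + 1)) = n i \<bullet> (y - x i)"
  using n_normal[of i] by (simp_all add: inner_diff_right)

lemma p_vertex:
  "p i (x i) = 0" "dir_deriv v (p i) (x i) = 0"
  "p i (x (i + 1)) = 0" "dir_deriv v (p i) (x (i + 1)) = 0"
proof -
  have 1: "p i (x i) = 0" for i
    using data[of "Vertex_Value i"] by (simp add: dofs_def)
  have "partial_x (p i) (x i) = 0" "partial_y (p i) (x i) = 0" for i
    using data[of "Vertex_Dx i"] data[of "Vertex_Dy i"] by (simp_all add: dofs_def)
  then have 2: "dir_deriv v (p i) (x i) = 0" for i v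
    by (rule dir_deriv_zero_from_basis[OF polynomial_map_p, rotated -2, where e="axis 2 1"])
       (simp_all add: axis_eq_0_iff inner_axis_axis)
  show "p i (x i) = 0" "dir_deriv v (p i) (x i) = 0" by (fact 1 2)+
  show "p i (x (i + 1)) = 0" using 1[of "i + 1"] jump_vertex(1)[of "i + 1"] by (simp add: jump_simps)
  have "dir_deriv v (jump (i + 1)) (x (i + 1)) = 0" by (rule jump_vertex)
  then show "dir_deriv v (p i) (x (i + 1)) = 0"
    using 2[of v "i + 1"] by (simp add: jump_def dir_deriv_diff polynomial_map_p)
qed

lemma p_divisible_by_square:
  "\<exists>q. q \<in> poly_space (k - 2) \<and> (\<forall>y. p i y = (n i \<bullet> (y - x i)) ^ 2 * q y)"
proof -
  have m: "k - 1 > 0" "k - 2 > 0" using k by simp_all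
  have zero: "p i (x (i + 1) + t *\<^sub>R (x i - x (i + 1))) = 0" for t
  proof (rule vanishes_on_segment_line[OF degree m(2), of "{0..k - 2}" "{0, k - 2}"])
    show "p i (segment_node (k - 2) j (x i) (x (i + 1))) = 0" if "j \<in> {0..k - 2}" for j
    proof -
      have "j = 0 \<or> j = k - 2 \<or> j \<in> {1..k - 3}" using that k by auto
      then consider "j = 0" | "j = k - 2" | "j \<in> {1..k - 3}" by blast
      then show ?thesis
      proof cases
        case 3
        then show ?thesis using data[of "Edge_Value i j"] by (simp add: dofs_def)
      qed (simp_all add: segment_node_ends[OF m(2)] p_vertex)
    qed
    show "dir_deriv (x i - x (i + 1)) (p i) (segment_node (k - 2) j (x i) (x (i + 1))) = 0"
      if "j \<in> {0, k - 2}" for j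
      using that by (auto simp: segment_node_ends[OF m(2)] p_vertex)
  qed (use k in auto)
  have deriv: "dir_deriv (n i) (p i) (x (i + 1) + t *\<^sub>R (x i - x (i + 1))) = 0" for t
  proof (rule vanishes_on_segment_line[OF dir_deriv_in_poly_space[OF degree] m(1), of "{0..k - 1}" "{}"])
    show "dir_deriv (n i) (p i) (segment_node (k - 1) j (x i) (x (i + 1))) = 0"
      if "j \<in> {0..k - 1}" for j
    proof -
      have "j = 0 \<or> j = k - 1 \<or> j \<in> {1..k - 2}" using that k by auto
      then consider "j = 0" | "j = k - 1" | "j \<in> {1..k - 2}" by blast
      then show ?thesis
      proof cases
        case 3
        then show ?thesis using data[of "Edge_Normal i j"] by (simp add: dofs_def)
      qed (simp_all add: segment_node_ends[OF m(1), simplified] p_vertex)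
    qed
  qed (use k in auto)
  have "x i - x (i + 1) \<noteq> 0" "n i \<bullet> n i \<noteq> 0" using adjacent_vertices_neq[of i] n_neq_0 by simp_all
  then obtain q where "q \<in> poly_space (k - 2)" "\<And>y. p i y = (n i \<bullet> (y - x (i + 1))) ^ 2 * q y"
    using poly_space_factor_twice[OF degree n_neq_0 _ on_side(1) _ zero deriv] by blast
  then show ?thesis unfolding on_side(2) by blast
qed

text \<open>
  At a vertex two adjacent pieces are \<open>l\<close>-th powers of independent linear forms times cofactors,
  and their difference is divisible by the square of a third form; so both cofactors vanish there.
  These are the two end values of a cofactor that the degrees of freedom on a side omit.
\<close>

lemma cofactor_vertex:
  assumes q: "\<And>i. polynomial_map (q i)" and l: "l > 0"
    and p: "\<And>i y. p i y = (n i \<bullet> (y - x i)) ^ l * q i y"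
  shows "q i (x i) = 0" "q i (x (i + 1)) = 0"
proof -
  have both: "q i (x (i + 1)) = 0 \<and> q (i + 1) (x (i + 1)) = 0" for i
  proof -
    define z where "z = x (i + 1)"
    have idx: "i + 1 + 1 = i + 2" "i + 1 + 3 = i" by (simp_all add: add.assoc)
    obtain e r where r: "polynomial_map r" and e: "e \<bullet> (x (i + 1) - x0) = 0"
      and jump: "\<And>y. jump (i + 1) y = (e \<bullet> (y - x0)) ^ 2 * r y"
      by (rule jump_square) (rule that)
    have ni: "n i \<bullet> (y - x i) = n i \<bullet> (y - z)" for y using on_side(2) by (simp add: z_def)
    have ez: "e \<bullet> (y - x0) = e \<bullet> (y - z)" for y using e by (simp add: z_def inner_diff_right)
    have eq: "(n (i + 1) \<bullet> (y - z)) ^ l * q (i + 1) y - (n i \<bullet> (y - z)) ^ l * q i y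
        = (e \<bullet> (y - z)) ^ 2 * r y" for y
      using jump[of y] p[of "i + 1" y] p[of i y] by (simp add: jump_simps ni ez z_def)
    have eq': "(n i \<bullet> (y - z)) ^ l * q i y - (n (i + 1) \<bullet> (y - z)) ^ l * q (i + 1) y
        = (e \<bullet> (y - z)) ^ 2 * ((-1) * r y)" for y
      using eq[of y] by simp
    have w: "e \<bullet> (x0 - z) = 0" using ez[of x0] by simp
    have nw: "n i \<bullet> (x0 - z) \<noteq> 0" "n (i + 1) \<bullet> (x0 - z) \<noteq> 0"
      using side_normal(3)[OF n_neq_0 n_normal] ni z_def by metis+
    have v: "n (i + 1) \<bullet> (x (i + 2) - z) = 0" "n i \<bullet> (x i - z) = 0"
      using n_normal[of "i + 1"] on_side(1)[of i] idx by (simp_all add: z_def)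
    have nv: "n i \<bullet> (x (i + 2) - z) \<noteq> 0" "n (i + 1) \<bullet> (x i - z) \<noteq> 0"
      using side_normal(1)[OF n_neq_0 n_normal, of i] ni[of "x (i + 2)"]
        side_normal(2)[OF n_neq_0 n_normal, of "i + 1"] idx by (simp_all add: z_def)
    have r': "polynomial_map (\<lambda>y. (-1) * r y)" by (intro polynomial_map_intros r)
    have "q i z = 0"
      by (rule square_divides_power_combination[OF q q r l eq w nw(1) v(1) nv(1)])
    moreover have "q (i + 1) z = 0"
      by (rule square_divides_power_combination[OF q q r' l eq' w nw(2) v(2) nv(2)])
    ultimately show ?thesis by (simp add: z_def)
  qed
  show "q i (x i) = 0" "q i (x (i + 1)) = 0" using both[of "i - 1"] both[of i] by simp_all
qed

lemma cofactor_on_side: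
  assumes q: "\<And>i. q i \<in> poly_space (k - l)" and l: "2 \<le> l" "l < k"
    and p: "\<And>i y. p i y = (n i \<bullet> (y - x i)) ^ l * q i y"
  shows "q i (x (i + 1) + t *\<^sub>R (x i - x (i + 1))) = 0"
proof -
  have m: "k - l > 0" using l by simp
  show ?thesis
  proof (rule vanishes_on_segment_line[OF q m, of "{0..k - l}" "{}"])
    show "q i (segment_node (k - l) j (x i) (x (i + 1))) = 0" (is "q i ?y = 0")
      if "j \<in> {0..k - l}" for j
    proof -
      have "j = 0 \<or> j = k - l \<or> j \<in> {1..k - 1 - l}" using that l by auto
      then consider "j = 0" | "j = k - l" | "j \<in> {1..k - 1 - l}" by blast
      then show ?thesis
      proof cases
        case 3
        then have "Edge_Higher i l j \<in> dofs k" using l by (auto simp: dofs_def)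
        from data[OF this] have "(dir_deriv (n i) ^^ l) (p i) ?y = 0" by simp
        moreover have "p i = (\<lambda>y. (n i \<bullet> (y - x i)) ^ l * q i y)" using p by auto
        moreover have "n i \<bullet> (?y - x i) = 0"
          using on_side(1)[of i] unfolding on_side(2)[symmetric] by (simp add: segment_node_eq[OF m])
        ultimately have "fact l * (n i \<bullet> n i) ^ l * q i ?y = 0"
          using iterated_dir_deriv_on_line[OF polynomial_mapI[OF q]] by simp
        then show ?thesis using n_neq_0[of i] by simp
      qed (use cofactor_vertex[OF polynomial_mapI[OF q] _ p] l in \<open>simp_all add: segment_node_ends[OF m, simplified]\<close>)
    qed
  qed auto
qed

text \<open>
  Vanishing of the cofactor on the side supplies one further factor, as long as \<open>l < k\<close>.
\<close>

lemma p_divisible_by_power: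
  assumes "2 \<le> l" "l \<le> k"
  shows "\<exists>q. \<forall>i. q i \<in> poly_space (k - l) \<and> (\<forall>y. p i y = (n i \<bullet> (y - x i)) ^ l * q i y)"
  using assms
proof (induction l rule: dec_induct)
  case base
  show ?case using p_divisible_by_square by (rule choice[OF allI])
next
  case (step l)
  then obtain q where q: "\<And>i. q i \<in> poly_space (k - l)"
    and p: "\<And>i y. p i y = (n i \<bullet> (y - x i)) ^ l * q i y" by auto
  have "\<exists>r. r \<in> poly_space (k - Suc l) \<and> (\<forall>y. p i y = (n i \<bullet> (y - x i)) ^ Suc l * r y)" for i
  proof -
    have "x i - x (i + 1) \<noteq> 0" using adjacent_vertices_neq[of i] by simp
    moreover have "q i (x (i + 1) + t *\<^sub>R (x i - x (i + 1))) = 0" for t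
      using step by (intro cofactor_on_side[OF q _ _ p]) auto
    ultimately obtain r where "r \<in> poly_space (k - l - 1)"
      "\<And>y. q i y = (n i \<bullet> (y - x (i + 1))) * r y"
      using poly_space_factor[OF q n_neq_0 _ on_side(1)] by blast
    then show ?thesis using p unfolding on_side(2) by (intro exI[of _ r]) simp
  qed
  then show ?case by (rule choice[OF allI])
qed

lemma pieces_zero: "p i y = 0"
proof -
  have "\<exists>q. \<forall>i. q i \<in> poly_space (k - k) \<and> (\<forall>y. p i y = (n i \<bullet> (y - x i)) ^ k * q i y)"
    using k by (intro p_divisible_by_power) auto
  then obtain q where q: "\<And>i. q i \<in> poly_space 0"
    and p: "\<And>i y. p i y = (n i \<bullet> (y - x i)) ^ k * q i y" by auto
  have "q i y = q i (x i)" using q[of i] by (auto simp: poly_space_def)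
  also have "\<dots> = 0" using cofactor_vertex(1)[OF polynomial_mapI[OF q] _ p] k by simp
  finally show ?thesis using p by simp
qed

end


section \<open>Counting degrees of freedom and constraints\<close>

lemma card_UNIV_4: "card (UNIV :: 4 set) = 4"
  by simp

lemma dofs_card:
  assumes "k \<ge> 3"
  shows "finite (dofs k)" "card (dofs k) + 2 * k = 2 * k ^ 2 + 4"
proof -
  obtain m where k: "k = m + 3" using assms by (metis add.commute le_Suc_ex)
  define A B C where "A = (UNIV :: 4 set) \<times> {1..k - 2}" and "B = (UNIV :: 4 set) \<times> {1..k - 3}"
    and "C = (UNIV :: 4 set) \<times> (SIGMA l:{2..k - 2}. {1..k - 1 - l})"
  define eA eB eC where "eA = (\<lambda>(i, j). Edge_Normal i j)" and "eB = (\<lambda>(i, j). Edge_Value i j)"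
    and "eC = (\<lambda>(i, l, j). Edge_Higher i l j)"
  have eq: "dofs k = range Vertex_Value \<union> (range Vertex_Dx \<union> (range Vertex_Dy \<union>
      (eA ` A \<union> (eB ` B \<union> eC ` C))))"
    unfolding dofs_def A_def B_def C_def eA_def eB_def eC_def by (auto simp: image_iff)
  have fin: "finite A" "finite B" "finite C" by (auto simp: A_def B_def C_def)
  show "finite (dofs k)" unfolding eq using fin by simp
  have inj: "inj_on eA A" "inj_on eB B" "inj_on eC C" "inj Vertex_Value" "inj Vertex_Dx" "inj Vertex_Dy"
    by (auto simp: inj_on_def eA_def eB_def eC_def)
  have "card (dofs k) = card (range Vertex_Value) + (card (range Vertex_Dx) + (card (range Vertex_Dy)
      + (card (eA ` A) + (card (eB ` B) + card (eC ` C)))))"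
    unfolding eq using fin
    by (subst card_Un_disjoint; (auto simp: eA_def eB_def eC_def; fail)?)+
  also have "\<dots> = 12 + card A + card B + card C"
    using inj by (simp add: card_image)
  finally have card: "card (dofs k) = 12 + card A + card B + card C" .
  have S: "2 * (\<Sum>l = 2..m + 1. m + 2 - l) = m * (m + 1)"
  proof -
    have "(\<Sum>l = 2..m + 1. m + 2 - l) = (\<Sum>l = 2..m + 1. l - 1)"
      by (rule sum.reindex_bij_witness[of _ "\<lambda>l. m + 3 - l" "\<lambda>l. m + 3 - l"]) auto
    moreover have "2 * (\<Sum>l = 2..m + 1. l - 1) = m * (m + 1)" by (induction m) auto
    ultimately show ?thesis by simp
  qed
  have "card C = 4 * (\<Sum>l = 2..m + 1. m + 2 - l)"
    by (simp add: C_def card_cartesian_product k)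
  with S have "card C = 2 * (m * (m + 1))" by linarith
  then show "card (dofs k) + 2 * k = 2 * k ^ 2 + 4"
    unfolding card by (simp add: A_def B_def card_cartesian_product k power2_eq_square algebra_simps)
qed

lemma constraints_card:
  assumes "k \<ge> 3"
  shows "finite (constraints k)" "card (constraints k) = 8 * k"
proof -
  obtain m where k: "k = m + 3" using assms by (metis add.commute le_Suc_ex)
  define A B where "A = (UNIV :: 4 set) \<times> {1..k - 3}"
    and "B = (SIGMA i:UNIV :: 4 set. {1..(if i = 3 then k - 3 else k - 2)})"
  define eA eB where "eA = (\<lambda>(i, j). Match_Edge_Value i j)" and "eB = (\<lambda>(i, j). Match_Edge_Normal i j)"
  have eq: "constraints k = range Match_Value \<union> (range Match_Dx \<union> (range Match_Dy \<union>
      (eA ` A \<union> (eB ` B \<union>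
      (Centre_Value ` {2, 3, 4} \<union> (Centre_Normal24 ` {2, 3, 4} \<union> Centre_Normal13 ` {2, 3, 4}))))))"
  proof -
    have "{Match_Edge_Value i j |i j. j \<in> {1..k - 3}} = eA ` A"
      unfolding A_def eA_def by force
    moreover have "{Match_Edge_Normal i j |i j. j \<in> {1..(if i = 3 then k - 3 else k - 2)}} = eB ` B"
      unfolding B_def eB_def by force
    ultimately show ?thesis unfolding constraints_def by (simp only: Un_assoc)
  qed
  have fin: "finite A" "finite B" by (auto simp: A_def B_def)
  show "finite (constraints k)" unfolding eq using fin by simp
  have inj: "inj_on eA A" "inj_on eB B" "inj Match_Value" "inj Match_Dx" "inj Match_Dy"
    "inj_on Centre_Value S" "inj_on Centre_Normal24 S" "inj_on Centre_Normal13 S" for S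
    by (auto simp: inj_on_def eA_def eB_def)
  have "card (constraints k) = card (range Match_Value) + (card (range Match_Dx) + (card (range Match_Dy)
      + (card (eA ` A) + (card (eB ` B) + (card (Centre_Value ` {2, 3, 4})
      + (card (Centre_Normal24 ` {2, 3, 4}) + card (Centre_Normal13 ` {2, 3, 4})))))))"
    unfolding eq using fin
    by (subst card_Un_disjoint; (auto simp: eA_def eB_def; fail)?)+
  also have "\<dots> = 12 + card A + card B + 3 * card {2, 3, 4 :: 4}"
    using inj by (simp only: card_image card_UNIV_4)
  also have "card B = 4 * m + 3"
  proof -
    have "card B = (\<Sum>i::4\<in>UNIV. if i = 3 then k - 3 else k - 2)"
      unfolding B_def by (subst card_SigmaI) (auto intro: sum.cong)
    then show ?thesis unfolding sum_4 by (simp add: k)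
  qed
  finally show "card (constraints k) = 8 * k"
    by (simp add: A_def card_cartesian_product k)
qed

section \<open>Unisolvence\<close>

text \<open>
  Both families of linear functionals are indexed by one sum type, so that they form the rows of a
  single linear system.
\<close>

definition functional_value ::
  "nat \<Rightarrow> (4 \<Rightarrow> real^2) \<Rightarrow> real^2 \<Rightarrow> (4 \<Rightarrow> real^2) \<Rightarrow> (real^2 \<Rightarrow> real^2 \<Rightarrow> real^2)
     \<Rightarrow> (4 \<Rightarrow> real^2 \<Rightarrow> real) \<Rightarrow> dof + constr \<Rightarrow> real" where
  "functional_value k x x0 n \<nu> p = case_sum (dof_value k x n p) (constr_value k x x0 \<nu> p)"

lemma functional_value_add:
  assumes "\<And>i. polynomial_map (p i)" "\<And>i. polynomial_map (q i)"
  shows "functional_value k x x0 n \<nu> (\<lambda>i y. p i y + q i y) \<phi>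
    = functional_value k x x0 n \<nu> p \<phi> + functional_value k x x0 n \<nu> q \<phi>"
proof (cases \<phi>)
  case (Inl \<delta>)
  then show ?thesis using assms
    by (cases \<delta>) (simp_all add: functional_value_def dir_deriv_add iterated_dir_deriv_add)
next
  case (Inr \<gamma>)
  then show ?thesis using assms
    by (cases \<gamma>) (simp_all add: functional_value_def Let_def dir_deriv_add dir_deriv_diff
        polynomial_map_intros(3))
qed

lemma functional_value_scale:
  assumes "\<And>i. polynomial_map (p i)"
  shows "functional_value k x x0 n \<nu> (\<lambda>i y. c * p i y) \<phi> = c * functional_value k x x0 n \<nu> p \<phi>"
proof -
  have *: "polynomial_map (\<lambda>y. c * p i y)" for i
    using polynomial_map_intros(5)[OF polynomial_map_intros(1) assms] .
  show ?thesis
  proof (cases \<phi>)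
    case (Inl \<delta>)
    then show ?thesis using assms
      by (cases \<delta>) (simp_all add: functional_value_def dir_deriv_scale iterated_dir_deriv_scale)
  next
    case (Inr \<gamma>)
    then show ?thesis using assms *
      by (cases \<gamma>) (simp_all add: functional_value_def Let_def dir_deriv_scale dir_deriv_diff
          right_diff_distrib)
  qed
qed

lemma functional_value_sum:
  assumes "finite S" "\<And>m i. polynomial_map (B m i)"
  shows "functional_value k x x0 n \<nu> (\<lambda>i y. \<Sum>m\<in>S. c m * B m i y) \<phi>
    = (\<Sum>m\<in>S. c m * functional_value k x x0 n \<nu> (B m) \<phi>)"
  using assms(1)
proof (induction S)
  case empty
  show ?case
    using functional_value_scale[of "\<lambda>i y. 0" k x x0 n \<nu> 0 \<phi>] polynomial_map_intros(1) by simp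
next
  case (insert m S)
  have "polynomial_map (\<lambda>y. c m * B m i y)" for i m
    by (intro polynomial_map_intros assms)
  moreover have "polynomial_map (\<lambda>y. \<Sum>m\<in>S. c m * B m i y)" for i
    using insert.hyps(1) by (induction S) (use calculation in \<open>auto intro: polynomial_map_intros\<close>)
  ultimately show ?case
    using insert assms(2) by (simp add: functional_value_add functional_value_scale)
qed

lemma solves_iff_functional_value:
  "solves k x x0 n \<nu> d p \<longleftrightarrow> (\<forall>i. p i \<in> poly_space k) \<and>
    (\<forall>\<phi> \<in> dofs k <+> constraints k. functional_value k x x0 n \<nu> p \<phi> = case_sum d (\<lambda>_. 0) \<phi>)"
  unfolding solves_def functional_value_def Plus_def by (simp add: ball_Un)

definition exponents :: "nat \<Rightarrow> (nat \<times> nat) set" where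
  "exponents k = (SIGMA a:{..k}. {..k - a})"

definition piece_monomial :: "4 \<times> nat \<times> nat \<Rightarrow> 4 \<Rightarrow> real^2 \<Rightarrow> real" where
  "piece_monomial = (\<lambda>(j, a, b) i y. if i = j then (y $ 1) ^ a * (y $ 2) ^ b else 0)"

lemma card_exponents: "2 * card (exponents k) = (k + 1) * (k + 2)"
proof -
  have "card (exponents k) = (\<Sum>a\<le>k. Suc (k - a))" by (simp add: exponents_def)
  also have "\<dots> = (\<Sum>a\<le>k. Suc a)"
    by (rule sum.reindex_bij_witness[of _ "\<lambda>a. k - a" "\<lambda>a. k - a"]) auto
  moreover have "2 * (\<Sum>a\<le>k. Suc a) = (k + 1) * (k + 2)" by (induction k) auto
  ultimately show ?thesis by simp
qed

lemma sum_piece_monomial: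
  "(\<Sum>m\<in>UNIV \<times> exponents k. c m * piece_monomial m i y)
    = (\<Sum>a\<le>k. \<Sum>b\<le>k - a. c (i, a, b) * (y $ 1) ^ a * (y $ 2) ^ b)"
proof -
  have "(\<Sum>m\<in>UNIV \<times> exponents k. c m * piece_monomial m i y)
      = (\<Sum>j\<in>UNIV. \<Sum>(a, b)\<in>exponents k. c (j, a, b) * piece_monomial (j, a, b) i y)"
    by (simp add: sum.cartesian_product split_def)
  also have "\<dots> = (\<Sum>j\<in>UNIV. if i = j then
      (\<Sum>(a, b)\<in>exponents k. c (i, a, b) * (y $ 1) ^ a * (y $ 2) ^ b) else 0)"
    by (intro sum.cong refl) (auto simp: piece_monomial_def split_def mult.assoc intro!: sum.neutral)
  also have "\<dots> = (\<Sum>(a, b)\<in>exponents k. c (i, a, b) * (y $ 1) ^ a * (y $ 2) ^ b)" by simp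
  also have "\<dots> = (\<Sum>a\<le>k. \<Sum>b\<le>k - a. c (i, a, b) * (y $ 1) ^ a * (y $ 2) ^ b)"
    unfolding exponents_def by (subst sum.Sigma) auto
  finally show ?thesis .
qed

lemma polynomial_map_piece_monomial: "polynomial_map (piece_monomial m i)"
proof -
  obtain j a b where m: "m = (j, a, b)" by (cases m)
  show ?thesis
  proof (cases "i = j")
    case True
    then have "piece_monomial m i = (\<lambda>y. 1 * (y $ 1) ^ a * (y $ 2) ^ b)"
      by (simp add: m piece_monomial_def)
    then show ?thesis using monomial_in_poly_space[of a b "a + b" 1] polynomial_mapI by simp
  next
    case False
    then have "piece_monomial m i = (\<lambda>y. 0)" by (simp add: m piece_monomial_def)
    then show ?thesis using polynomial_map_intros(1) by simp
  qed
qed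

text \<open>
  Polynomial pieces have \<open>4 (k + 1) (k + 2) / 2 = (2 k\<^sup>2 - 2 k + 4) + 8 k\<close> coefficients, as many as
  there are conditions, so uniqueness for zero data already yields existence for all data.
\<close>

lemma exists_solution:
  assumes k: "k \<ge> 3"
    and unique: "\<And>p i y. solves k x x0 n \<nu> (\<lambda>_. 0) p \<Longrightarrow> p i y = 0"
  shows "\<exists>p. solves k x x0 n \<nu> d p"
proof -
  define I where "I = (UNIV :: 4 set) \<times> exponents k"
  define P where "P c = (\<lambda>i y. \<Sum>m\<in>I. c m * piece_monomial m i y)" for c :: "4 \<times> nat \<times> nat \<Rightarrow> real"
  have finI: "finite I" by (simp add: I_def exponents_def)
  have P_degree: "P c i \<in> poly_space k" for c i
    unfolding P_def I_def sum_piece_monomial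
    by (intro poly_space_sum monomial_in_poly_space) auto
  have P_value: "functional_value k x x0 n \<nu> (P c) \<phi>
      = (\<Sum>m\<in>I. c m * functional_value k x x0 n \<nu> (piece_monomial m) \<phi>)" for c \<phi>
    unfolding P_def by (intro functional_value_sum finI polynomial_map_piece_monomial)
  have "\<exists>c. \<forall>\<phi>\<in>dofs k <+> constraints k.
      (\<Sum>m\<in>I. c m * functional_value k x x0 n \<nu> (piece_monomial m) \<phi>) = case_sum d (\<lambda>_. 0) \<phi>"
  proof (rule square_system_solvable[OF finI])
    show "finite (dofs k <+> constraints k)"
      using dofs_card(1)[OF k] constraints_card(1)[OF k] by simp
    have "card I = 4 * card (exponents k)" by (simp add: I_def card_cartesian_product)
    then have "card I = 2 * ((k + 1) * (k + 2))" using card_exponents[of k] by simp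
    moreover have "card (dofs k <+> constraints k) = card (dofs k) + card (constraints k)"
      by (rule card_Plus[OF dofs_card(1)[OF k] constraints_card(1)[OF k]])
    ultimately show "card I = card (dofs k <+> constraints k)"
      using dofs_card(2)[OF k] constraints_card(2)[OF k]
      by (simp add: power2_eq_square algebra_simps)
    show "\<forall>m\<in>I. c m = 0"
      if zero: "\<And>\<phi>. \<phi> \<in> dofs k <+> constraints k \<Longrightarrow>
        (\<Sum>m\<in>I. c m * functional_value k x x0 n \<nu> (piece_monomial m) \<phi>) = 0" for c
    proof -
      have "case_sum (\<lambda>_. 0) (\<lambda>_. 0) \<phi> = (0 :: real)" for \<phi> :: "dof + constr" by (cases \<phi>) auto
      then have "solves k x x0 n \<nu> (\<lambda>_. 0) (P c)"
        unfolding solves_iff_functional_value using P_degree P_value zero by simp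
      then have "P c i y = 0" for i y by (rule unique)
      then have "(\<Sum>a\<le>k. \<Sum>b\<le>k - a. c (i, a, b) * (y $ 1) ^ a * (y $ 2) ^ b) = 0" for i and y :: "real^2"
        unfolding P_def I_def sum_piece_monomial .
      then have "c (i, a, b) = 0" if "a + b \<le> k" for i a b
        using poly_space_coefficients_unique[of "\<lambda>a b. c (i, a, b)" k, OF _ that] by blast
      then show ?thesis by (auto simp: I_def exponents_def)
    qed
  qed
  then obtain c where "\<forall>\<phi>\<in>dofs k <+> constraints k. functional_value k x x0 n \<nu> (P c) \<phi> = case_sum d (\<lambda>_. 0) \<phi>"
    unfolding P_value by blast
  then have "solves k x x0 n \<nu> d (P c)" unfolding solves_iff_functional_value using P_degree by blast
  then show ?thesis by blast
qed

lemma solves_diff: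
  assumes "solves k x x0 n \<nu> d p" "solves k x x0 n \<nu> d q"
  shows "solves k x x0 n \<nu> (\<lambda>_. 0) (\<lambda>i y. p i y - q i y)"
proof -
  have poly: "p i \<in> poly_space k" "q i \<in> poly_space k" for i
    using assms by (simp_all add: solves_def)
  then have "polynomial_map (p i)" "polynomial_map (q i)" "polynomial_map (\<lambda>y. (-1) * q i y)" for i
    using polynomial_mapI poly_space_scale by blast+
  then have "functional_value k x x0 n \<nu> (\<lambda>i y. p i y + (-1) * q i y) \<phi>
      = functional_value k x x0 n \<nu> p \<phi> + (-1) * functional_value k x x0 n \<nu> q \<phi>" for \<phi>
    by (simp only: functional_value_add functional_value_scale)
  moreover have "case_sum (\<lambda>_. 0) (\<lambda>_. 0) \<phi> = (0 :: real)" for \<phi> :: "dof + constr" by (cases \<phi>) auto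
  ultimately show ?thesis
    using assms poly unfolding solves_iff_functional_value by (simp add: poly_space_diff)
qed

theorem lemma3p2:
  fixes k :: nat
    and x :: "4 \<Rightarrow> real^2" and x0 :: "real^2"
    and n :: "4 \<Rightarrow> real^2" and \<nu> :: "real^2 \<Rightarrow> real^2 \<Rightarrow> real^2"
  assumes "k \<ge> 3"
    and "convex_quadrilateral x"
    and "x0 \<in> closed_segment (x 1) (x 3)" and "x0 \<in> closed_segment (x 2) (x 4)"
    and "\<And>i. norm (n i) = 1" and "\<And>i. normal_direction (n i) (x i) (x (i + 1))"
    and "\<And>a b. a \<noteq> b \<Longrightarrow> normal_direction (\<nu> a b) a b"
  shows "finite (dofs k) \<and> int (card (dofs k)) = 2 * int k ^ 2 - 2 * int k + 4 \<and>
    finite (constraints k) \<and> card (constraints k) = 8 * k \<and>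
    (\<forall>d :: dof \<Rightarrow> real.
       (\<exists>!p :: 4 \<Rightarrow> real^2 \<Rightarrow> real. solves k x x0 n \<nu> d p) \<and>
       (\<forall>p. solves k x x0 n \<nu> d p \<longrightarrow>
          (\<exists>f. (\<forall>i. \<forall>y \<in> subtriangle x x0 i. f y = p i y) \<and> C1_on (quad x) f)))"
proof (intro conjI allI impI)
  have matched: "matched_pieces x x0 k \<nu> p" if "solves k x x0 n \<nu> d p" for d p
    by unfold_locales (use assms(1-4,7) that in \<open>auto simp: solves_def\<close>)
  have zero: "p i y = 0" if sol: "solves k x x0 n \<nu> (\<lambda>_. 0) p" for p i y
  proof -
    interpret matched_pieces x x0 k \<nu> p using sol by (rule matched)
    interpret matched_pieces_zero_data x x0 k \<nu> p n
      by unfold_locales (use assms(6) sol in \<open>auto simp: solves_def normal_direction_def\<close>)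
    show ?thesis by (rule pieces_zero)
  qed
  show "finite (dofs k)" "finite (constraints k)" "card (constraints k) = 8 * k"
    using assms(1) by (simp_all add: dofs_card constraints_card)
  have "int (card (dofs k) + 2 * k) = int (2 * k ^ 2 + 4)" using dofs_card(2)[OF assms(1)] by simp
  then show "int (card (dofs k)) = 2 * int k ^ 2 - 2 * int k + 4" by simp
  show "\<exists>!p. solves k x x0 n \<nu> d p" for d
  proof -
    have "p = q" if "solves k x x0 n \<nu> d p" "solves k x x0 n \<nu> d q" for p q
      using zero[OF solves_diff[OF that]] by (simp add: fun_eq_iff)
    moreover have "\<exists>p. solves k x x0 n \<nu> d p" using assms(1) zero by (rule exists_solution)
    ultimately show ?thesis by blast
  qed
  show "\<exists>f. (\<forall>i. \<forall>y \<in> subtriangle x x0 i. f y = p i y) \<and> C1_on (quad x) f"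
    if "solves k x x0 n \<nu> d p" for d p
    using matched_pieces.piecewise_C1[OF matched[OF that]] .
qed

end
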